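(* Let $\mathcal{A}\subset\mathbb{R}^t$ be a compact set, let $f:[0,\infty)\to[0,\infty]$ be lower semi-continuous, and let $K:\mathcal{A}\times\mathcal{A}\to[0,\infty]$ be given by $K(x,y)=f(|x-y|)$. Assume that: (A1) there is a $\mu\in\mathcal{M}(\mathcal{A})$ with $I[\mu]<\infty$; (A2) the kernel $K$ has a unique $K$-equilibrium measure, denoted $\mu_{\mathrm{eq}}$; (A3) the support of $\mu_{\mathrm{eq}}$ is all of $\mathcal{A}$; (A4) the potential $U^{e}(x):=\int_{\mathcal{A}}K(x,y)\,d\mu_{\mathrm{eq}}(y)$ is equal to a positive constant, denoted $W_K$, on all of $\mathcal{A}$. Then: i) $\displaystyle\lim_{N\to\infty}\mathcal{P}(\mathcal{A},N)=W_K$. ii) For any sequence $\{\omega_N^*\}_{N\geq2}$ of polarization optimal configurations (with $\omega_N^*\in\mathcal{A}^N$) having corresponding normalized counting measures $\{\nu_N^*\}_{N\geq2}$, $\nu_N^*$ converges weakly to $\mu_{\mathrm{eq}}$ as $N\to\infty$. iii) $\mu_{\mathrm{eq}}$ is the unique polarization extremal measure.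
   Context: $|\cdot|$ is the Euclidean norm on $\mathbb{R}^t$. $\mathcal{M}(\mathcal{A})$ is the set of (positive, Borel) probability measures with support in $\mathcal{A}$. For $\mu\in\mathcal{M}(\mathcal{A})$, its potential is $U^{\mu}(x):=\int_{\mathcal{A}}K(x,y)\,d\mu(y)$ and its $K$-energy is $I[\mu]:=\int_{\mathcal{A}}\int_{\mathcal{A}}K(x,y)\,d\mu(x)\,d\mu(y)\in[0,\infty]$. A $K$-equilibrium measure is a measure $\mu\in\mathcal{M}(\mathcal{A})$ with $I[\mu]=\inf_{\nu\in\mathcal{M}(\mathcal{A})}I[\nu]$. An $N$-point configuration $\omega_N=(a_1,\ldots,a_N)\in\mathcal{A}^N$ consists of $N$ possibly non-distinct points of $\mathcal{A}$; its normalized counting measure is $\frac1N\sum_{j=1}^N\delta_{a_j}$ (multiplicities counted). The polarization of $\omega_N$ is $$P(\omega_N):=\min_{x\in\mathcal{A}}\frac{1}{N}\sum_{j=1}^N K(x,a_j),$$ and $\mathcal{P}(\mathcal{A},N):=\sup_{\omega_N\in\mathcal{A}^N}P(\omega_N)$. A configuration $\omega_N^*\in\mathcal{A}^N$ is polarization optimal if $P(\omega_N^* )=\mathcal{P}(\mathcal{A},N)$. A polarization extremal measure is a measure $\mu\in\mathcal{M}(\mathcal{A})$ that achieves the supremum $\sup_{\mu\in\mathcal{M}(\mathcal{A})}\min_{x\in\mathcal{A}}U^{\mu}(x)$. Weak convergence $\nu_N\to\mu$ means $\int g\,d\nu_N\to\int g\,d\mu$ for every continuous $g:\mathcal{A}\to\mathbb{R}$.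 *)

theory Defs
  imports "HOL-Probability.Probability"
begin

text \<open>Functions with values in \<open>[0,\<infinity>]\<close> are \<open>ennreal\<close>-valued. A kernel on \<open>A \<times> A\<close> is a total
  function of which only the values on \<open>A \<times> A\<close> are used.\<close>

definition lower_semicontinuous_on ::
    "'a::topological_space set \<Rightarrow> ('a \<Rightarrow> 'b::linorder) \<Rightarrow> bool" where
  "lower_semicontinuous_on S f \<longleftrightarrow>
     (\<forall>x\<in>S. \<forall>c<f x. eventually (\<lambda>y. c < f y) (at x within S))"

definition measure_support :: "'a::topological_space measure \<Rightarrow> 'a set" where
  "measure_support \<mu> = {x. \<forall>U. open U \<and> x \<in> U \<longrightarrow> 0 < emeasure \<mu> U}"

definition prob_measures_on :: "'a::topological_space set \<Rightarrow> 'a measure set" where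
  "prob_measures_on A = {\<mu>. sets \<mu> = sets borel \<and> prob_space \<mu> \<and> measure_support \<mu> \<subseteq> A}"

definition potential ::
    "'a::topological_space set \<Rightarrow> ('a \<Rightarrow> 'a \<Rightarrow> ennreal) \<Rightarrow> 'a measure \<Rightarrow> 'a \<Rightarrow> ennreal" where
  "potential A K \<mu> x = (\<integral>\<^sup>+y\<in>A. K x y \<partial>\<mu>)"

definition energy ::
    "'a::topological_space set \<Rightarrow> ('a \<Rightarrow> 'a \<Rightarrow> ennreal) \<Rightarrow> 'a measure \<Rightarrow> ennreal" where
  "energy A K \<mu> = (\<integral>\<^sup>+y\<in>A. (\<integral>\<^sup>+x\<in>A. K x y \<partial>\<mu>) \<partial>\<mu>)"

definition equilibrium_measure ::
    "'a::topological_space set \<Rightarrow> ('a \<Rightarrow> 'a \<Rightarrow> ennreal) \<Rightarrow> 'a measure \<Rightarrow> bool" where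
  "equilibrium_measure A K \<mu> \<longleftrightarrow>
     \<mu> \<in> prob_measures_on A \<and> energy A K \<mu> = (INF \<nu>\<in>prob_measures_on A. energy A K \<nu>)"

definition configurations :: "'a set \<Rightarrow> nat \<Rightarrow> (nat \<Rightarrow> 'a) set" where
  "configurations A N = {1..N} \<rightarrow>\<^sub>E A"

definition counting_measure :: "nat \<Rightarrow> (nat \<Rightarrow> 'a::topological_space) \<Rightarrow> 'a measure" where
  "counting_measure N \<omega> = distr (uniform_count_measure {1..N}) borel \<omega>"

text \<open>The minima over \<open>A\<close> below are written as infima. For the kernels in question they are
  attained, see \<open>potential_attains_INF\<close> and \<open>polarization_attained\<close>.\<close>

definition polarization ::
    "'a set \<Rightarrow> ('a \<Rightarrow> 'a \<Rightarrow> ennreal) \<Rightarrow> nat \<Rightarrow> (nat \<Rightarrow> 'a) \<Rightarrow> ennreal" where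
  "polarization A K N \<omega> = (INF x\<in>A. (\<Sum>j=1..N. K x (\<omega> j)) / of_nat N)"

definition max_polarization ::
    "'a set \<Rightarrow> ('a \<Rightarrow> 'a \<Rightarrow> ennreal) \<Rightarrow> nat \<Rightarrow> ennreal" where
  "max_polarization A K N = (SUP \<omega>\<in>configurations A N. polarization A K N \<omega>)"

definition polarization_optimal ::
    "'a set \<Rightarrow> ('a \<Rightarrow> 'a \<Rightarrow> ennreal) \<Rightarrow> nat \<Rightarrow> (nat \<Rightarrow> 'a) \<Rightarrow> bool" where
  "polarization_optimal A K N \<omega> \<longleftrightarrow>
     \<omega> \<in> configurations A N \<and> polarization A K N \<omega> = max_polarization A K N"

definition polarization_extremal ::
    "'a::topological_space set \<Rightarrow> ('a \<Rightarrow> 'a \<Rightarrow> ennreal) \<Rightarrow> 'a measure \<Rightarrow> bool" where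
  "polarization_extremal A K \<mu> \<longleftrightarrow>
     \<mu> \<in> prob_measures_on A \<and>
     (INF x\<in>A. potential A K \<mu> x) =
       (SUP \<nu>\<in>prob_measures_on A. INF x\<in>A. potential A K \<nu> x)"

definition weakly_converges_on ::
    "'a::topological_space set \<Rightarrow> (nat \<Rightarrow> 'a measure) \<Rightarrow> 'a measure \<Rightarrow> bool" where
  "weakly_converges_on A \<nu> \<mu> \<longleftrightarrow>
     (\<forall>g::'a \<Rightarrow> real. continuous_on A g \<longrightarrow>
        (\<lambda>N. \<integral>x\<in>A. g x \<partial>\<nu> N) \<longlonglongrightarrow> (\<integral>x\<in>A. g x \<partial>\<mu>))"

lemma nn_integral_counting_measure:
  fixes \<omega> :: "nat \<Rightarrow> 'a::topological_space"
  assumes "N > 0" "g \<in> borel_measurable borel"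
  shows "(\<integral>\<^sup>+x. g x \<partial>counting_measure N \<omega>) = (\<Sum>j=1..N. g (\<omega> j)) / of_nat N"
proof -
  have m: "\<omega> \<in> measurable (uniform_count_measure {1..N}) borel"
    by (auto simp: measurable_def sets_uniform_count_measure space_uniform_count_measure)
  have *: "ennreal (1 / real N) = 1 / of_nat N"
    using assms by (simp add: ennreal_of_nat_eq_real_of_nat divide_ennreal flip: ennreal_1)
  have "(\<integral>\<^sup>+x. g x \<partial>counting_measure N \<omega>) = (\<integral>\<^sup>+j. g (\<omega> j) \<partial>uniform_count_measure {1..N})"
    unfolding counting_measure_def using m assms by (simp add: nn_integral_distr)
  also have "\<dots> = (\<Sum>j=1..N. 1 / of_nat N * g (\<omega> j))"
    by (simp add: uniform_count_measure_def nn_integral_point_measure_finite *)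
  also have "\<dots> = (\<Sum>j=1..N. g (\<omega> j)) / of_nat N"
    by (simp add: divide_ennreal_def sum_distrib_left mult.commute)
  finally show ?thesis .
qed

lemma emeasure_counting_measure:
  fixes \<omega> :: "nat \<Rightarrow> 'a::topological_space"
  assumes "N > 0" "B \<in> sets borel"
  shows "emeasure (counting_measure N \<omega>) B =
    (\<Sum>j=1..N. emeasure (return borel (\<omega> j)) B) / of_nat N"
proof -
  have "emeasure (counting_measure N \<omega>) B = (\<integral>\<^sup>+x. indicator B x \<partial>counting_measure N \<omega>)"
    using assms by (subst nn_integral_indicator) (auto simp: counting_measure_def)
  also have "\<dots> = (\<Sum>j=1..N. indicator B (\<omega> j)) / of_nat N"
    using assms by (intro nn_integral_counting_measure) auto
  finally show ?thesis
    using assms by simp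
qed

lemma lsc_kernel_eventually:
  fixes f :: "real \<Rightarrow> ennreal" and x y :: "'a::real_normed_vector"
  assumes "lower_semicontinuous_on {0..} f" "c < f (norm (x - y))"
  shows "eventually (\<lambda>z. c < f (norm (x - z))) (nhds y)"
    and "eventually (\<lambda>z. c < f (norm (z - y))) (nhds x)"
proof -
  have "eventually (\<lambda>t. c < f t) (at (norm (x - y)) within {0..})"
    using assms by (auto simp: lower_semicontinuous_on_def)
  then obtain U where U: "open U" "norm (x - y) \<in> U"
      "\<And>t. t \<in> U \<Longrightarrow> t \<noteq> norm (x - y) \<Longrightarrow> t \<ge> 0 \<Longrightarrow> c < f t"
    by (auto simp: eventually_at_topological)
  have U': "c < f t" if "t \<in> U" "t \<ge> 0" for t
    using U(3) that assms(2) by (cases "t = norm (x - y)") auto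
  have "((\<lambda>z. norm (x - z)) \<longlongrightarrow> norm (x - y)) (nhds y)"
    by (intro tendsto_intros filterlim_ident)
  from topological_tendstoD[OF this U(1,2)]
  show "eventually (\<lambda>z. c < f (norm (x - z))) (nhds y)"
    by (rule eventually_mono) (auto intro: U')
  have "((\<lambda>z. norm (z - y)) \<longlongrightarrow> norm (x - y)) (nhds x)"
    by (intro tendsto_intros filterlim_ident)
  from topological_tendstoD[OF this U(1,2)]
  show "eventually (\<lambda>z. c < f (norm (z - y))) (nhds x)"
    by (rule eventually_mono) (auto intro: U')
qed

lemma lsc_kernel_measurable:
  fixes f :: "real \<Rightarrow> ennreal" and x :: "'a::real_normed_vector"
  assumes "lower_semicontinuous_on {0..} f"
  shows "(\<lambda>y. f (norm (x - y))) \<in> borel_measurable borel"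
proof (rule borel_measurableI_greater)
  fix c
  have "open {y. c < f (norm (x - y))}"
    unfolding open_subopen[of "{y. c < f (norm (x - y))}"]
    using lsc_kernel_eventually(1)[OF assms] by (fastforce simp: eventually_nhds)
  then show "{y \<in> space borel. c < f (norm (x - y))} \<in> sets borel"
    by simp
qed

lemma potential_attains_INF:
  fixes A :: "'a::euclidean_space set"
  assumes A: "compact A" "A \<noteq> {}" and f: "lower_semicontinuous_on {0..} f"
    and K: "\<And>x y. x \<in> A \<Longrightarrow> y \<in> A \<Longrightarrow> K x y = f (norm (x - y))"
    and \<mu>: "sets \<mu> = sets borel"
  shows "\<exists>x\<in>A. potential A K \<mu> x = (INF x\<in>A. potential A K \<mu> x)"
proof -
  let ?U = "\<lambda>x. \<integral>\<^sup>+y\<in>A. f (norm (x - y)) \<partial>\<mu>"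
  have U: "potential A K \<mu> x = ?U x" if "x \<in> A" for x
    unfolding potential_def using that
    by (intro nn_integral_cong) (auto simp: indicator_def K)
  have eq: "(INF x\<in>A. potential A K \<mu> x) = (INF x\<in>A. ?U x)"
    using U by (intro INF_cong) auto
  define m where "m = (INF x\<in>A. ?U x)"
  obtain u where u: "range u \<subseteq> ?U ` A" "u \<longlonglongrightarrow> m"
    using Inf_as_limit[of "?U ` A"] A(2) unfolding m_def by auto
  have "\<forall>n. \<exists>x\<in>A. u n = ?U x" using u(1) by auto
  then obtain X where X: "\<And>n. X n \<in> A" "\<And>n. u n = ?U (X n)" by metis
  obtain x r where x: "x \<in> A" "strict_mono r" "(X \<circ> r) \<longlonglongrightarrow> x"
    using A(1) X(1) unfolding compact_def by metis
  have [measurable]: "A \<in> sets \<mu>" using A(1) \<mu> by (auto simp: compact_imp_closed)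
  have m: "(\<lambda>y. f (norm (z - y)) * indicator A y) \<in> borel_measurable \<mu>" for z
    using lsc_kernel_measurable[OF f, of z] \<mu>
    by (intro borel_measurable_times_ennreal) (auto cong: measurable_cong_sets)
  have "f (norm (x - y)) \<le> liminf (\<lambda>n. f (norm (X (r n) - y)))" for y
  proof (rule le_Liminf_iff[THEN iffD2], intro allI impI)
    fix c assume "c < f (norm (x - y))"
    from lsc_kernel_eventually(2)[OF f this] x(3)
    show "\<forall>\<^sub>F n in sequentially. c < f (norm (X (r n) - y))"
      by (auto simp: filterlim_iff o_def)
  qed
  then have "?U x \<le> (\<integral>\<^sup>+y. liminf (\<lambda>n. f (norm (X (r n) - y)) * indicator A y) \<partial>\<mu>)"
    by (intro nn_integral_mono) (auto simp: indicator_def)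
  also have "\<dots> \<le> liminf (\<lambda>n. ?U (X (r n)))"
    using m by (intro nn_integral_liminf)
  also have "\<dots> = m"
    using LIMSEQ_subseq_LIMSEQ[OF u(2) x(2)]
    by (intro lim_imp_Liminf) (auto simp: o_def X(2))
  finally have "?U x \<le> m" .
  moreover have "m \<le> ?U x" unfolding m_def using x(1) by (rule INF_lower)
  ultimately show ?thesis using x(1) U eq unfolding m_def by force
qed

lemma potential_counting_measure:
  fixes A :: "'a::euclidean_space set"
  assumes "compact A" and f: "lower_semicontinuous_on {0..} f"
    and K: "\<And>x y. x \<in> A \<Longrightarrow> y \<in> A \<Longrightarrow> K x y = f (norm (x - y))"
    and "N > 0" "\<omega> \<in> configurations A N" "x \<in> A"
  shows "potential A K (counting_measure N \<omega>) x = (\<Sum>j=1..N. K x (\<omega> j)) / of_nat N"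
proof -
  have \<omega>: "\<omega> j \<in> A" if "j \<in> {1..N}" for j
    using assms(5) that unfolding configurations_def by (rule PiE_mem)
  have [measurable]: "A \<in> sets borel" using assms(1) by (auto simp: compact_imp_closed)
  have m: "(\<lambda>y. f (norm (x - y)) * indicator A y) \<in> borel_measurable borel"
    using lsc_kernel_measurable[OF f, of x] by measurable
  have "potential A K (counting_measure N \<omega>) x =
      (\<integral>\<^sup>+y\<in>A. f (norm (x - y)) \<partial>counting_measure N \<omega>)"
    unfolding potential_def using assms(6)
    by (intro nn_integral_cong) (auto simp: indicator_def K)
  also have "\<dots> = (\<Sum>j=1..N. f (norm (x - \<omega> j)) * indicator A (\<omega> j)) / of_nat N"
    using assms(4) m by (rule nn_integral_counting_measure)
  also have "(\<Sum>j=1..N. f (norm (x - \<omega> j)) * indicator A (\<omega> j)) = (\<Sum>j=1..N. K x (\<omega> j))"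
    using \<omega> assms(6) by (intro sum.cong) (auto simp: K)
  finally show ?thesis .
qed

lemma polarization_attained:
  fixes A :: "'a::euclidean_space set"
  assumes "compact A" "A \<noteq> {}" "lower_semicontinuous_on {0..} f"
    and "\<And>x y. x \<in> A \<Longrightarrow> y \<in> A \<Longrightarrow> K x y = f (norm (x - y))"
    and "N > 0" "\<omega> \<in> configurations A N"
  shows "\<exists>x\<in>A. polarization A K N \<omega> = (\<Sum>j=1..N. K x (\<omega> j)) / of_nat N"
proof -
  let ?V = "\<lambda>x. (\<Sum>j=1..N. K x (\<omega> j)) / of_nat N"
  have V: "potential A K (counting_measure N \<omega>) x = ?V x" if "x \<in> A" for x
    using potential_counting_measure[of A f K N \<omega> x] assms that by blast
  have "polarization A K N \<omega> = (INF x\<in>A. potential A K (counting_measure N \<omega>) x)"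
    unfolding polarization_def using V by (intro INF_cong) auto
  moreover obtain x where "x \<in> A" "potential A K (counting_measure N \<omega>) x =
      (INF x\<in>A. potential A K (counting_measure N \<omega>) x)"
    using potential_attains_INF[of A f K "counting_measure N \<omega>"] assms(1-4)
    by (auto simp: counting_measure_def)
  ultimately show ?thesis using V by metis
qed

end

theory Submission
  imports Defs
begin

text \<open>Integrating \<open>U\<^sup>\<nu>\<close> against \<open>\<mu>\<^sub>e\<^sub>q\<close> and using symmetry of the kernel gives \<open>W\<^sub>K\<close>, so no potential of a
  probability measure on \<open>A\<close> has infimum above \<open>W\<^sub>K\<close>. The kernel is an increasing limit of bounded
  Lipschitz kernels. By a Dini argument the potential of \<open>\<mu>\<^sub>e\<^sub>q\<close> for one of these is close to \<open>W\<^sub>K\<close>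
  uniformly on \<open>A\<close>, and replacing \<open>\<mu>\<^sub>e\<^sub>q\<close> by an \<open>N\<close>-point discretization gives configurations of
  polarization close to \<open>W\<^sub>K\<close>. Conversely, let the infima of the potentials of \<open>\<nu>\<^sub>n\<close> tend to \<open>W\<^sub>K\<close>, and let
  \<open>\<nu>\<close> be a weak limit point. As their \<open>\<mu>\<^sub>e\<^sub>q\<close>-means are \<open>W\<^sub>K\<close> and \<open>\<mu>\<^sub>e\<^sub>q\<close> has full support, \<open>U\<^sup>\<nu> \<le> W\<^sub>K\<close> on \<open>A\<close>,
  hence the energy of \<open>\<nu>\<close> is minimal and \<open>\<nu> = \<mu>\<^sub>e\<^sub>q\<close>. Optimal configurations and, as constant sequences,
  extremal measures are instances.\<close>

section \<open>Supports and almost sure membership\<close>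

text \<open>A point outside the support has a null open neighbourhood, and by Lindelof the union of
  all null open sets is null. This turns the topological support condition into an almost-everywhere
  statement usable under integrals.\<close>

lemma AE_in_closed_iff_measure_support:
  fixes \<mu> :: "'a::second_countable_topology measure"
  assumes "sets \<mu> = sets borel" "closed A"
  shows "(AE x in \<mu>. x \<in> A) \<longleftrightarrow> measure_support \<mu> \<subseteq> A"
proof
  have null: "(AE x in \<mu>. x \<in> A) \<longleftrightarrow> emeasure \<mu> (- A) = 0"
    using assms sets_eq_imp_space_eq[OF assms(1)]
    by (intro AE_iff_measurable) (auto intro: borel_closed)
  show "measure_support \<mu> \<subseteq> A" if "AE x in \<mu>. x \<in> A"
    using that assms(2) null unfolding measure_support_def by (force simp: closed_def)
  show "AE x in \<mu>. x \<in> A" if supp: "measure_support \<mu> \<subseteq> A"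
  proof -
    let ?F = "{U. open U \<and> emeasure \<mu> U = 0}"
    obtain F where F: "F \<subseteq> ?F" "countable F" "\<Union>F = \<Union>?F"
      using Lindelof[of ?F] by blast
    have "F \<subseteq> null_sets \<mu>"
      using F(1) assms(1) by (auto intro!: null_setsI)
    then have "\<Union>F \<in> null_sets \<mu>"
      using null_sets_UN'[of F "\<lambda>U. U" \<mu>] F(2) by auto
    moreover have "- A \<in> sets \<mu>"
      using assms by (auto intro: borel_closed)
    moreover have "- A \<subseteq> \<Union>F"
    proof
      fix x assume "x \<in> - A"
      then have "x \<notin> measure_support \<mu>"
        using supp by blast
      then obtain U where "open U" "x \<in> U" "emeasure \<mu> U = 0"
        by (auto simp: measure_support_def not_less)
      then show "x \<in> \<Union>F"
        unfolding F(3) by blast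
    qed
    ultimately have "- A \<in> null_sets \<mu>"
      by (rule null_sets_subset)
    then show ?thesis
      using null by auto
  qed
qed

lemma prob_measures_on_iff:
  fixes A :: "'a::second_countable_topology set"
  assumes "closed A"
  shows "\<mu> \<in> prob_measures_on A \<longleftrightarrow>
    sets \<mu> = sets borel \<and> prob_space \<mu> \<and> (AE x in \<mu>. x \<in> A)"
  using AE_in_closed_iff_measure_support[OF _ assms]
  by (auto simp: prob_measures_on_def)

subsection \<open>Weak compactness\<close>

text \<open>At the first disagreement \<open>k\<close> the terms differ by \<open>(1/3)^k\<close>,
  while all later terms together contribute at most half of that. Base 3 with digits 0 and 1 leaves
  this gap; in base 2 the tail could cancel the leading difference.\<close>

lemma ternary_expansion_agree:
  fixes P Q :: "nat \<Rightarrow> bool"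
  defines "s \<equiv> \<lambda>R. \<Sum>j. of_bool (R j) * (1/3 :: real) ^ j"
  assumes close: "\<bar>s P - s Q\<bar> < (1/3) ^ n / 2" and "j < n"
  shows "P j \<longleftrightarrow> Q j"
proof (rule ccontr)
  assume "\<not> (P j \<longleftrightarrow> Q j)"
  define k where "k = (LEAST j. P j \<noteq> Q j)"
  have k: "P k \<noteq> Q k"
    using \<open>\<not> (P j \<longleftrightarrow> Q j)\<close> unfolding k_def by (rule LeastI)
  have before_k: "P i = Q i" if "i < k" for i
    using that not_less_Least unfolding k_def by blast
  have "k \<le> j"
    using \<open>\<not> (P j \<longleftrightarrow> Q j)\<close> unfolding k_def by (rule Least_le)
  have summ: "summable (\<lambda>j. of_bool (R j) * (1/3 :: real) ^ j)" for R
    by (rule summable_comparison_test'[of "\<lambda>j. (1/3 :: real) ^ j" 0])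
       (auto intro: summable_geometric)
  define d where "d i = of_bool (P i) * (1/3 :: real) ^ i - of_bool (Q i) * (1/3) ^ i" for i
  have d: "summable d" "suminf d = s P - s Q"
    using summable_diff[OF summ summ] suminf_diff[OF summ summ] unfolding d_def s_def by simp_all
  have "(\<Sum>i<Suc k. d i) = d k"
    using before_k by (simp add: d_def)
  then have split: "s P - s Q = (\<Sum>i. d (i + Suc k)) + d k"
    using suminf_split_initial_segment[OF d(1), of "Suc k"] d(2) by simp
  have geom: "(\<lambda>i. (1/3 :: real) ^ (i + Suc k)) sums ((1/3) ^ k / 2)"
    using sums_mult[OF geometric_sums[of "1/3 :: real"], of "(1/3) ^ Suc k"]
    by (simp add: power_add mult.commute)
  have bound: "norm (d i) \<le> (1/3) ^ i" for i
    by (simp add: d_def)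
  have "\<bar>\<Sum>i. d (i + Suc k)\<bar> \<le> (\<Sum>i. (1/3 :: real) ^ (i + Suc k))"
    using norm_suminf_le[of "\<lambda>i. d (i + Suc k)", OF bound sums_summable[OF geom]] by simp
  also have "\<dots> = (1/3) ^ k / 2"
    using geom by (simp add: sums_iff)
  finally have "\<bar>\<Sum>i. d (i + Suc k)\<bar> \<le> (1/3) ^ k / 2" .
  moreover have "\<bar>d k\<bar> = (1/3) ^ k"
    using k by (auto simp: d_def)
  ultimately have "(1/3) ^ k / 2 \<le> \<bar>s P - s Q\<bar>"
    unfolding split by linarith
  moreover have "(1/3 :: real) ^ n \<le> (1/3) ^ k"
    using \<open>k \<le> j\<close> \<open>j < n\<close> by (intro power_decreasing) auto
  ultimately show False
    using close by linarith
qed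

text \<open>Digit \<open>j\<close> of \<open>e x\<close> records whether \<open>x\<close> lies in
  the basic open set \<open>b j\<close>. Finitely many small basic sets cover \<open>A\<close>, so
  points of \<open>A\<close> whose codes agree on finitely many digits are close: although
  \<open>e\<close> itself is only shown to be measurable, its inverse is uniformly
  continuous.\<close>

lemma compact_real_encoding:
  fixes A :: "'a::{metric_space,second_countable_topology} set"
  assumes "compact A"
  obtains e :: "'a \<Rightarrow> real" where "e \<in> borel_measurable borel" "\<And>x. \<bar>e x\<bar> \<le> 3/2"
    "\<And>\<epsilon>. \<epsilon> > 0 \<Longrightarrow> \<exists>\<delta>>0. \<forall>x\<in>A. \<forall>y\<in>A. \<bar>e x - e y\<bar> < \<delta> \<longrightarrow> dist x y < \<epsilon>"
proof -
  obtain B :: "'a set set" where B: "countable B" "topological_basis B"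
    using ex_countable_basis by blast
  have "B \<noteq> {}"
    using topological_basisE[OF B(2) open_UNIV] by blast
  then have range_b: "range (from_nat_into B) = B"
    using B(1) by (rule range_from_nat_into)
  define b where "b = from_nat_into B"
  define s where "s R = (\<Sum>j. of_bool (R j) * (1/3 :: real) ^ j)" for R
  define e where "e x = s (\<lambda>j. x \<in> b j)" for x
  have open_b: "open (b j)" for j
    using range_b topological_basis_open[OF B(2)] unfolding b_def by blast
  show thesis
  proof
    have "(\<lambda>x. \<Sum>j. indicator (b j) x * (1/3 :: real) ^ j) \<in> borel_measurable borel"
      using open_b by (intro borel_measurable_suminf borel_measurable_times
          borel_measurable_indicator borel_measurable_const) auto
    also have "(\<lambda>x. \<Sum>j. indicator (b j) x * (1/3 :: real) ^ j) = e"
      by (auto simp: e_def s_def indicator_def of_bool_def fun_eq_iff)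
    finally show "e \<in> borel_measurable borel" .
  next
    fix x
    have geom: "(\<lambda>j. (1/3 :: real) ^ j) sums (3/2)"
      using geometric_sums[of "1/3 :: real"] by simp
    have "norm (e x) \<le> (\<Sum>j. (1/3 :: real) ^ j)"
      unfolding e_def s_def using sums_summable[OF geom] by (intro norm_suminf_le) auto
    then show "\<bar>e x\<bar> \<le> 3/2"
      using sums_unique[OF geom] by simp
  next
    fix \<epsilon> :: real assume "\<epsilon> > 0"
    let ?J = "{j. \<forall>x\<in>b j. \<forall>y\<in>b j. dist x y < \<epsilon>}"
    have "\<exists>j\<in>?J. x \<in> b j" for x
    proof -
      obtain U where U: "U \<in> B" "x \<in> U" "U \<subseteq> ball x (\<epsilon>/2)"
        using topological_basisE[OF B(2) open_ball, of x x "\<epsilon>/2"] \<open>\<epsilon> > 0\<close> by auto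
      obtain j where "U = b j"
        using U(1) range_b unfolding b_def by blast
      moreover have "dist y z < \<epsilon>" if "y \<in> U" "z \<in> U" for y z
        using U(3) that dist_triangle_half_r[of x y \<epsilon> z] by (auto simp: subset_iff)
      ultimately show ?thesis
        using U(2) by blast
    qed
    then have "A \<subseteq> (\<Union>j\<in>?J. b j)"
      by blast
    then obtain J where J: "J \<subseteq> ?J" "finite J" "A \<subseteq> (\<Union>j\<in>J. b j)"
      by (rule compactE_image[OF assms open_b])
    obtain n where n: "\<And>j. j \<in> J \<Longrightarrow> j < n"
      using J(2) unfolding finite_nat_set_iff_bounded by blast
    show "\<exists>\<delta>>0. \<forall>x\<in>A. \<forall>y\<in>A. \<bar>e x - e y\<bar> < \<delta> \<longrightarrow> dist x y < \<epsilon>"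
    proof (intro exI[of _ "(1/3) ^ n / 2"] conjI ballI impI)
      fix x y assume "x \<in> A" and close: "\<bar>e x - e y\<bar> < (1/3) ^ n / 2"
      obtain j where j: "j \<in> J" "x \<in> b j"
        using J(3) \<open>x \<in> A\<close> by blast
      have "y \<in> b j"
        using ternary_expansion_agree[of "\<lambda>j. x \<in> b j" "\<lambda>j. y \<in> b j" n j] close n[OF j(1)] j(2)
        unfolding e_def s_def by blast
      then show "dist x y < \<epsilon>"
        using j J(1) by blast
    qed simp
  qed
qed

text \<open>Encoding the points of \<open>A\<close> by reals reduces the claim to Helly's selection theorem: the inverse
  of the encoding extends continuously to the whole line.\<close>

lemma prob_measures_on_compact_subseq:
  fixes A :: "'a::euclidean_space set" and M :: "nat \<Rightarrow> 'a measure"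
  assumes "compact A" and M: "\<And>n. M n \<in> prob_measures_on A"
  obtains r \<nu> where "strict_mono (r :: nat \<Rightarrow> nat)" "\<nu> \<in> prob_measures_on A"
    "weakly_converges_on A (\<lambda>n. M (r n)) \<nu>"
proof -
  have "closed A"
    using assms(1) by (rule compact_imp_closed)
  note pm = prob_measures_on_iff[OF this]
  have sets_M: "sets (M n) = sets borel" and prob_M: "prob_space (M n)"
    and AE_M: "AE x in M n. x \<in> A" for n
    using M pm by auto
  note [measurable_cong] = sets_M
  obtain e :: "'a \<Rightarrow> real" where [measurable]: "e \<in> borel_measurable borel"
    and e_bound: "\<And>x. \<bar>e x\<bar> \<le> 3/2"
    and e_inv: "\<And>\<epsilon>. \<epsilon> > 0 \<Longrightarrow> \<exists>\<delta>>0. \<forall>x\<in>A. \<forall>y\<in>A. \<bar>e x - e y\<bar> < \<delta> \<longrightarrow> dist x y < \<epsilon>"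
    using compact_real_encoding[OF assms(1)] by metis
  have "inj_on e A"
  proof (rule inj_onI, rule ccontr)
    fix x y assume "x \<in> A" "y \<in> A" "e x = e y" "x \<noteq> y"
    with e_inv[of "dist x y"] show False
      by (metis abs_zero cancel_comm_monoid_add_class.diff_cancel less_irrefl zero_less_dist_iff)
  qed
  have "uniformly_continuous_on (e ` A) (the_inv_into A e)"
    unfolding uniformly_continuous_on_def
  proof (intro allI impI)
    fix \<epsilon> :: real assume "\<epsilon> > 0"
    from e_inv[OF this] \<open>inj_on e A\<close>
    show "\<exists>d>0. \<forall>x\<in>e ` A. \<forall>x'\<in>e ` A. dist x' x < d \<longrightarrow>
        dist (the_inv_into A e x') (the_inv_into A e x) < \<epsilon>"
      by (force simp: the_inv_into_f_f dist_real_def)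
  qed
  \<comment> \<open>Uniform continuity extends the inverse to the closure of the set of codes, and
    Tietze extends it further to the whole line; \<open>\<phi>\<close> is then a left inverse of
    \<open>e\<close> on \<open>A\<close>.\<close>
  then obtain \<phi>0 where \<phi>0: "uniformly_continuous_on (closure (e ` A)) \<phi>0"
      "\<And>t. t \<in> e ` A \<Longrightarrow> the_inv_into A e t = \<phi>0 t"
    by (rule uniformly_continuous_on_extension_on_closure) blast
  obtain \<phi> where \<phi>: "continuous_on UNIV \<phi>" "\<And>t. t \<in> closure (e ` A) \<Longrightarrow> \<phi> t = \<phi>0 t"
    using Tietze_unbounded[OF uniformly_continuous_imp_continuous[OF \<phi>0(1)], of UNIV] by auto
  have \<phi>_e: "\<phi> (e x) = x" if "x \<in> A" for x
    using \<phi>(2)[of "e x"] \<phi>0(2)[of "e x"] that the_inv_into_f_f[OF \<open>inj_on e A\<close> that]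
      closure_subset[of "e ` A"] by auto
  have [measurable]: "\<phi> \<in> borel_measurable borel"
    using \<phi>(1) by (rule borel_measurable_continuous_onI)
  define L where "L n = distr (M n) borel e" for n
  have rd_L: "real_distribution (L n)" for n
    unfolding L_def by (rule prob_space.real_distribution_distr[OF prob_M]) measurable
  \<comment> \<open>All codes lie in \<open>[-3/2, 3/2]\<close>, so one bounded interval carries
    every \<open>L n\<close>.\<close>
  have "tight L"
    unfolding tight_def
  proof (intro conjI allI impI rd_L)
    fix \<epsilon> :: real assume "\<epsilon> > 0"
    have "measure (L n) {-2<..2} = 1" for n
    proof -
      have "e -` {-2<..2} \<inter> space (M n) = space (M n)"
      proof (intro equalityI subsetI IntI vimageI2)
        fix x assume "x \<in> space (M n)"
        show "e x \<in> {-2<..2}"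
          using e_bound[of x] by auto
      qed auto
      then show ?thesis
        unfolding L_def by (simp add: measure_distr prob_space.prob_space prob_M)
    qed
    then show "\<exists>a b. a < b \<and> (\<forall>n. 1 - \<epsilon> < measure (L n) {a<..b})"
      using \<open>\<epsilon> > 0\<close> by (intro exI[of _ "-2"] exI[of _ 2]) auto
  qed
  then obtain r N where r: "strict_mono (r :: nat \<Rightarrow> nat)" "real_distribution N" "weak_conv_m (L \<circ> id \<circ> r) N"
    using tight_imp_convergent_subsubsequence[of L id] by (auto simp: strict_mono_id)
  interpret N: real_distribution N by fact
  \<comment> \<open>Pushing the Helly limit forward along \<open>\<phi>\<close> returns from codes
    to points.\<close>
  define \<nu> where "\<nu> = distr N borel \<phi>"
  have prob_\<nu>: "prob_space \<nu>"
    unfolding \<nu>_def by (rule N.prob_space_distr) measurable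
  have sets_\<nu>: "sets \<nu> = sets borel"
    by (simp add: \<nu>_def)
  have conv: "(\<lambda>n. \<integral>x. h x \<partial>M (r n)) \<longlonglongrightarrow> (\<integral>x. h x \<partial>\<nu>)"
    if h: "continuous_on UNIV h" "\<And>x. norm (h x) \<le> c" for h :: "'a \<Rightarrow> real" and c
  proof -
    have [measurable]: "h \<in> borel_measurable borel"
      using h(1) by (rule borel_measurable_continuous_onI)
    have "continuous_on UNIV (\<lambda>t. h (\<phi> t))"
      using continuous_on_compose2[OF h(1) \<phi>(1)] by simp
    then have "(\<lambda>n. \<integral>t. h (\<phi> t) \<partial>L (r n)) \<longlonglongrightarrow> (\<integral>t. h (\<phi> t) \<partial>N)"
      using r(2,3) rd_L h(2) unfolding o_def id_def
      by (intro weak_conv_imp_integral_bdd_continuous_conv[where B=c])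
         (auto simp: continuous_on_eq_continuous_at)
    also have "(\<integral>t. h (\<phi> t) \<partial>N) = (\<integral>x. h x \<partial>\<nu>)"
      unfolding \<nu>_def by (subst integral_distr) auto
    also have "(\<lambda>n. \<integral>t. h (\<phi> t) \<partial>L (r n)) = (\<lambda>n. \<integral>x. h x \<partial>M (r n))"
    proof
      fix n
      have "(\<integral>t. h (\<phi> t) \<partial>L (r n)) = (\<integral>x. h (\<phi> (e x)) \<partial>M (r n))"
        by (simp add: L_def integral_distr)
      also have "\<dots> = (\<integral>x. h x \<partial>M (r n))"
        using AE_M[of "r n"] by (intro integral_cong_AE) (auto simp: \<phi>_e)
      finally show "(\<integral>t. h (\<phi> t) \<partial>L (r n)) = (\<integral>x. h x \<partial>M (r n))" .
    qed
    finally show ?thesis .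
  qed
  interpret \<nu>: prob_space \<nu> by fact
  have "A \<noteq> {}"
    using AE_M[of 0] prob_space.AE_False[OF prob_M[of 0]] by (cases "A = {}") auto
  \<comment> \<open>The distance to \<open>A\<close>, capped at 1 to be bounded, is a test function
    vanishing exactly on \<open>A\<close>; its integrals are 0 along the sequence, hence in the
    limit, so \<open>\<nu>\<close> is concentrated on \<open>A\<close>.\<close>
  have cont_infdist: "continuous_on UNIV (\<lambda>x. min 1 (infdist x A))"
    by (intro continuous_intros)
  note [measurable] = borel_measurable_continuous_onI[OF this]
  have bound_infdist: "norm (min 1 (infdist x A)) \<le> 1" for x
    using infdist_nonneg[of x A] by auto
  have "(\<integral>x. min 1 (infdist x A) \<partial>M (r n)) = 0" for n
    using AE_M[of "r n"]
    by (intro integral_eq_zero_AE) (auto elim!: eventually_mono)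
  with conv[OF cont_infdist bound_infdist] have "(\<integral>x. min 1 (infdist x A) \<partial>\<nu>) = 0"
    by (simp add: LIMSEQ_const_iff)
  moreover have "integrable \<nu> (\<lambda>x. min 1 (infdist x A))"
    using bound_infdist by (intro \<nu>.integrable_const_bound[where B=1]) (auto simp: \<nu>_def)
  ultimately have "AE x in \<nu>. min 1 (infdist x A) = 0"
    by (subst (asm) integral_nonneg_eq_0_iff_AE) (auto simp: infdist_nonneg)
  then have AE_\<nu>: "AE x in \<nu>. x \<in> A"
  proof eventually_elim
    case (elim x)
    then have "infdist x A = 0"
      by (auto simp: min_def split: if_splits)
    then show ?case
      using \<open>closed A\<close> \<open>A \<noteq> {}\<close> by (simp add: in_closed_iff_infdist_zero)
  qed
  show thesis
  proof
    show "strict_mono r" by fact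
    show "\<nu> \<in> prob_measures_on A"
      using AE_\<nu> prob_\<nu> sets_\<nu> pm by auto
    show "weakly_converges_on A (\<lambda>n. M (r n)) \<nu>"
      unfolding weakly_converges_on_def
    proof (intro allI impI)
      fix g :: "'a \<Rightarrow> real" assume g: "continuous_on A g"
      then obtain c where "\<forall>x\<in>A. norm (g x) \<le> c"
        using compact_imp_bounded[OF compact_continuous_image[OF g assms(1)]]
        by (auto simp: bounded_iff)
      then have c: "norm (g x) \<le> \<bar>c\<bar>" if "x \<in> A" for x
        using that by fastforce
      \<comment> \<open>The test function lives on \<open>A\<close> only; a bounded continuous
        extension makes \<open>conv\<close> applicable.\<close>
      obtain h where h: "continuous_on UNIV h" "\<And>x. x \<in> A \<Longrightarrow> h x = g x"
          "\<And>x. x \<in> UNIV \<Longrightarrow> norm (h x) \<le> \<bar>c\<bar>"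
        using Tietze[OF g _ abs_ge_zero c, of UNIV] \<open>closed A\<close> by auto
      have [measurable]: "h \<in> borel_measurable borel"
        using h(1) by (rule borel_measurable_continuous_onI)
      have eq: "(\<integral>x\<in>A. g x \<partial>P) = (\<integral>x. h x \<partial>P)" if "sets P = sets borel" "AE x in P. x \<in> A" for P
      proof -
        note [measurable_cong] = that(1)
        have [measurable]: "A \<in> sets borel"
          using \<open>closed A\<close> by auto
        have "(\<integral>x\<in>A. g x \<partial>P) = (\<integral>x\<in>A. h x \<partial>P)"
          unfolding set_lebesgue_integral_def
          by (intro Bochner_Integration.integral_cong) (auto simp: indicator_def h(2))
        also have "\<dots> = (\<integral>x. h x \<partial>P)"
          unfolding set_lebesgue_integral_def using that(2) by (intro integral_cong_AE) auto
        finally show ?thesis .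
      qed
      show "(\<lambda>n. \<integral>x\<in>A. g x \<partial>M (r n)) \<longlonglongrightarrow> (\<integral>x\<in>A. g x \<partial>\<nu>)"
        using conv[OF h(1) h(3)] eq sets_M AE_M sets_\<nu> AE_\<nu> by simp
    qed
  qed
qed

subsection \<open>Lipschitz kernels\<close>

text \<open>The approximations are the inf-convolutions of the truncations \<open>min f m\<close> with the cone of slope \<open>m\<close>.\<close>

lemma lower_semicontinuous_SUP_Lipschitz:
  fixes f :: "real \<Rightarrow> ennreal"
  assumes f: "lower_semicontinuous_on {0..} f"
  obtains k :: "nat \<Rightarrow> real \<Rightarrow> real" where
    "\<And>m s t. \<bar>k m s - k m t\<bar> \<le> real m * \<bar>s - t\<bar>"
    "\<And>m t. 0 \<le> t \<Longrightarrow> 0 \<le> k m t \<and> k m t \<le> real m"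
    "\<And>m n t. m \<le> n \<Longrightarrow> k m t \<le> k n t"
    "\<And>t. 0 \<le> t \<Longrightarrow> (SUP m. ennreal (k m t)) = f t"
proof -
  \<comment> \<open>Capping at \<open>m\<close> makes the values finite, so the construction can
    proceed in the reals.\<close>
  define h where "h m s = enn2real (min (f s) (of_nat m))" for m s
  have h: "ennreal (h m s) = min (f s) (of_nat m)" for m s
    unfolding h_def by (intro ennreal_enn2real) (auto simp: min_less_iff_disj of_nat_less_top)
  have h_nonneg: "0 \<le> h m s" for m s
    by (simp add: h_def)
  have h_le: "h m s \<le> real m" for m s
  proof -
    have "ennreal (h m s) \<le> ennreal (real m)"
      by (simp add: h ennreal_of_nat_eq_real_of_nat)
    then show ?thesis by simp
  qed
  have h_mono: "h m s \<le> h n s" if "m \<le> n" for m n s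
  proof -
    have "ennreal (h m s) \<le> ennreal (h n s)"
      unfolding h using that by (intro min.mono) auto
    then show ?thesis by (simp add: h_nonneg)
  qed
  \<comment> \<open>The infimum runs over \<open>s \<ge> 0\<close>, where \<open>f\<close> is
    controlled, while \<open>t\<close> ranges over the whole line, which gives a global Lipschitz
    bound.\<close>
  define k where "k m t = (INF s\<in>{0..}. h m s + real m * \<bar>t - s\<bar>)" for m t
  have bdd: "bdd_below ((\<lambda>s. h m s + real m * \<bar>t - s\<bar>) ` {0..})" for m t
    by (rule bdd_belowI2[where m=0]) (simp add: h_nonneg)
  have k_le: "k m t \<le> h m s + real m * \<bar>t - s\<bar>" if "0 \<le> s" for m t s
    unfolding k_def using bdd that by (intro cINF_lower) auto
  have k_ge: "c \<le> k m t" if "\<And>s. 0 \<le> s \<Longrightarrow> c \<le> h m s + real m * \<bar>t - s\<bar>" for c m t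
    unfolding k_def using that by (intro cINF_greatest) auto
  have lip: "k m s \<le> k m t + real m * \<bar>s - t\<bar>" for m s t
  proof -
    have "k m s - real m * \<bar>s - t\<bar> \<le> k m t"
    proof (rule k_ge)
      fix u :: real assume "0 \<le> u"
      have "real m * \<bar>s - u\<bar> \<le> real m * (\<bar>t - u\<bar> + \<bar>s - t\<bar>)"
        by (intro mult_left_mono) auto
      then show "k m s - real m * \<bar>s - t\<bar> \<le> h m u + real m * \<bar>t - u\<bar>"
        using k_le[OF \<open>0 \<le> u\<close>, of m s] by (simp add: algebra_simps)
    qed
    then show ?thesis by simp
  qed
  show thesis
  proof
    show "\<bar>k m s - k m t\<bar> \<le> real m * \<bar>s - t\<bar>" for m s t
      using lip[of m s t] lip[of m t s] by (simp add: abs_le_iff abs_minus_commute)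
    show "0 \<le> k m t \<and> k m t \<le> real m" if "0 \<le> t" for m t
      using k_le[OF that, of m t] h_le[of m t] by (auto intro!: k_ge simp: h_nonneg)
    show "k m t \<le> k n t" if "m \<le> n" for m n t
    proof (rule k_ge)
      fix s :: real assume "0 \<le> s"
      have "real m * \<bar>t - s\<bar> \<le> real n * \<bar>t - s\<bar>"
        using that by (intro mult_right_mono) auto
      then show "k m t \<le> h n s + real n * \<bar>t - s\<bar>"
        using k_le[OF \<open>0 \<le> s\<close>, of m t] h_mono[OF that, of s] by linarith
    qed
    show "(SUP m. ennreal (k m t)) = f t" if "0 \<le> t" for t
    proof (rule antisym)
      show "(SUP m. ennreal (k m t)) \<le> f t"
      proof (rule SUP_least)
        fix m
        have "ennreal (k m t) \<le> ennreal (h m t)"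
          using k_le[OF that, of m t] by (intro ennreal_leI) simp
        then show "ennreal (k m t) \<le> f t"
          by (simp add: h)
      qed
      show "f t \<le> (SUP m. ennreal (k m t))"
      proof (rule dense_le)
        fix c assume "c < f t"
        then obtain r where r: "0 \<le> r" "c = ennreal r"
          by (cases c) auto
        have "\<forall>\<^sub>F s in at t within {0..}. c < f s"
          using f \<open>c < f t\<close> that by (auto simp: lower_semicontinuous_on_def)
        then obtain d where d: "d > 0" "\<And>s. 0 \<le> s \<Longrightarrow> s \<noteq> t \<Longrightarrow> dist s t < d \<Longrightarrow> c < f s"
          by (auto simp: eventually_at)
        \<comment> \<open>Two demands on \<open>m\<close>: at least \<open>r\<close>, so that the
          cap does not spoil the lower bound \<open>r\<close> near \<open>t\<close>; at least
          \<open>r / d\<close>, so that the cone has reached \<open>r\<close> at distance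
          \<open>d\<close>.\<close>
        obtain m :: nat where m: "max r (r / d) \<le> real m"
          using real_arch_simple by blast
        have "r \<le> k m t"
        proof (rule k_ge)
          fix s :: real assume "0 \<le> s"
          show "r \<le> h m s + real m * \<bar>t - s\<bar>"
          proof (cases "\<bar>t - s\<bar> < d")
            case True
            then have "c \<le> f s"
              using d(2)[OF \<open>0 \<le> s\<close>] \<open>c < f t\<close> by (cases "s = t") (auto simp: dist_real_def abs_minus_commute)
            then have "ennreal r \<le> ennreal (h m s)"
              unfolding h using m r by (simp add: ennreal_of_nat_eq_real_of_nat ennreal_leI)
            then have "r \<le> h m s"
              by (simp add: h_nonneg)
            then show ?thesis
              by (simp add: add_increasing2)
          next
            case False
            have "r \<le> real m * d"
              using m d(1) by (simp add: pos_divide_le_eq)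
            also have "\<dots> \<le> real m * \<bar>t - s\<bar>"
              using False by (intro mult_left_mono) auto
            finally show ?thesis
              using h_nonneg[of m s] by simp
          qed
        qed
        then have "c \<le> ennreal (k m t)"
          using r by (simp add: ennreal_leI)
        then show "c \<le> (SUP m. ennreal (k m t))"
          by (rule SUP_upper2[OF UNIV_I])
      qed
    qed
  qed
qed

section \<open>Potentials of Lipschitz kernels and their discretization\<close>

text \<open>By the reverse triangle inequality \<open>norm (x - y)\<close> is 1-Lipschitz in
  \<open>x\<close> uniformly in \<open>y\<close>, so integration keeps the constant
  \<open>L\<close>, whatever the probability measure. A bound at one point thus spreads to a ball
  that is the same for all measures of a sequence.\<close>

lemma Lipschitz_potential:
  fixes \<nu> :: "'a::euclidean_space measure" and k :: "real \<Rightarrow> real"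
  assumes "prob_space \<nu>" and sets: "sets \<nu> = sets borel"
    and lip: "\<And>s t. \<bar>k s - k t\<bar> \<le> L * \<bar>s - t\<bar>"
    and bound: "\<And>t. 0 \<le> t \<Longrightarrow> 0 \<le> k t \<and> k t \<le> M"
  shows "integrable \<nu> (\<lambda>y. k (norm (x - y)))"
    and "\<bar>(\<integral>y. k (norm (x - y)) \<partial>\<nu>) - (\<integral>y. k (norm (x' - y)) \<partial>\<nu>)\<bar> \<le> L * norm (x - x')"
    and "continuous_on S (\<lambda>y. k (norm (x - y)))"
proof -
  interpret prob_space \<nu> by fact
  have "L \<ge> 0"
    using lip[of 1 0] by simp
  have "L-lipschitz_on UNIV k"
    using lip \<open>L \<ge> 0\<close> by (intro lipschitz_onI) (auto simp: dist_real_def)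
  then have "continuous_on UNIV k"
    by (rule lipschitz_on_continuous_on)
  then have cont: "continuous_on S (\<lambda>y. k (norm (x - y)))" for x S
    by (rule continuous_on_compose2) (auto intro!: continuous_intros)
  then show "continuous_on S (\<lambda>y. k (norm (x - y)))" .
  have int: "integrable \<nu> (\<lambda>y. k (norm (x - y)))" for x
    using borel_measurable_continuous_onI[OF cont] bound
    by (intro integrable_const_bound[where B=M]) (auto cong: measurable_cong_sets[OF sets])
  then show "integrable \<nu> (\<lambda>y. k (norm (x - y)))" .
  have "(\<integral>y. k (norm (x - y)) \<partial>\<nu>) \<le> (\<integral>y. k (norm (x' - y)) + L * norm (x - x') \<partial>\<nu>)" for x x'
  proof (intro integral_mono int Bochner_Integration.integrable_add integrable_const)
    fix y
    have "\<bar>norm (x - y) - norm (x' - y)\<bar> \<le> norm (x - x')"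
      using norm_triangle_ineq3[of "x - y" "x' - y"] by simp
    then have "L * \<bar>norm (x - y) - norm (x' - y)\<bar> \<le> L * norm (x - x')"
      using \<open>L \<ge> 0\<close> by (rule mult_left_mono)
    then show "k (norm (x - y)) \<le> k (norm (x' - y)) + L * norm (x - x')"
      using lip[of "norm (x - y)" "norm (x' - y)"] by linarith
  qed
  then have "(\<integral>y. k (norm (x - y)) \<partial>\<nu>) \<le> (\<integral>y. k (norm (x' - y)) \<partial>\<nu>) + L * norm (x - x')" for x x'
    using int by (simp add: prob_space)
  from this[of x x'] this[of x' x]
  show "\<bar>(\<integral>y. k (norm (x - y)) \<partial>\<nu>) - (\<integral>y. k (norm (x' - y)) \<partial>\<nu>)\<bar> \<le> L * norm (x - x')"
    by (simp add: abs_le_iff norm_minus_commute)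
qed

text \<open>Index \<open>i\<close> is used as often as the integer part of \<open>N * w i\<close>,
  and leftover places get index 0. Each rounding loses at most one copy, hence at most
  \<open>M\<close>. One \<open>\<sigma>\<close> serves all \<open>g\<close> and \<open>M\<close>, as
  needed for a bound uniform in the point \<open>x\<close>.\<close>

lemma weights_approximated_by_counts:
  fixes w :: "nat \<Rightarrow> real"
  assumes "0 < m" and w: "\<And>i. i < m \<Longrightarrow> 0 \<le> w i" "(\<Sum>i<m. w i) \<le> 1"
  obtains \<sigma> :: "nat \<Rightarrow> nat" where "\<And>j. \<sigma> j < m"
    "\<And>g M. (\<And>i. i < m \<Longrightarrow> 0 \<le> g i \<and> g i \<le> M) \<Longrightarrow>
      real N * (\<Sum>i<m. w i * g i) - real m * M \<le> (\<Sum>j=1..N. g (\<sigma> j))"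
proof -
  define n where "n i = nat \<lfloor>real N * w i\<rfloor>" for i
  have n_le: "real (n i) \<le> real N * w i" if "i < m" for i
    using w(1)[OF that] by (simp add: n_def)
  have n_ge: "real N * w i - 1 \<le> real (n i)" for i
    unfolding n_def by linarith
  have "real (\<Sum>i<m. n i) \<le> (\<Sum>i<m. real N * w i)"
    unfolding of_nat_sum using n_le by (intro sum_mono) auto
  also have "\<dots> \<le> real N"
    using mult_left_mono[OF w(2), of "real N"] by (simp flip: sum_distrib_left)
  finally have sum_n: "(\<Sum>i<m. n i) \<le> N"
    unfolding of_nat_le_iff .
  define ys where "ys = concat (map (\<lambda>i. replicate (n i) i) [0..<m])"
  define xs where "xs = ys @ replicate (N - (\<Sum>i<m. n i)) 0"
  have length_ys: "length ys = (\<Sum>i<m. n i)"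
    by (simp add: ys_def length_concat o_def sum_list_distinct_conv_sum_set flip: atLeast0LessThan)
  then have length_xs: "length xs = N"
    using sum_n by (simp add: xs_def)
  have set_xs: "set xs \<subseteq> {..<m}"
    using \<open>0 < m\<close> by (auto simp: xs_def ys_def)
  \<comment> \<open>Places are numbered from 1 but list positions from 0; the value 0 elsewhere
    keeps every \<open>\<sigma> j\<close> below \<open>m\<close>.\<close>
  define \<sigma> where "\<sigma> j = (if j \<in> {1..N} then xs ! (j - 1) else 0)" for j
  show thesis
  proof
    show "\<sigma> j < m" for j
    proof (cases "j \<in> {1..N}")
      case True
      then have "xs ! (j - 1) \<in> set xs"
        using length_xs by (intro nth_mem) auto
      then show ?thesis
        using True set_xs by (auto simp: \<sigma>_def)
    qed (use \<open>0 < m\<close> in \<open>auto simp: \<sigma>_def\<close>)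
  next
    fix g :: "nat \<Rightarrow> real" and M
    assume g: "\<And>i. i < m \<Longrightarrow> 0 \<le> g i \<and> g i \<le> M"
    have "real N * (w i * g i) - M \<le> real (n i) * g i" if "i < m" for i
    proof -
      have "(real N * w i - 1) * g i \<le> real (n i) * g i"
        using n_ge g[OF that] by (intro mult_right_mono) auto
      then show ?thesis
        using g[OF that] by (simp add: algebra_simps)
    qed
    then have "(\<Sum>i<m. real N * (w i * g i) - M) \<le> (\<Sum>i<m. real (n i) * g i)"
      by (intro sum_mono) auto
    also have "\<dots> = sum_list (map g ys)"
    proof -
      have "sum_list (map g (concat (map (\<lambda>i. replicate (n i) i) is))) =
          (\<Sum>i\<leftarrow>is. real (n i) * g i)" for "is"
        by (induction "is") (simp_all add: sum_list_replicate)
      then show ?thesis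
        unfolding ys_def
        by (simp add: sum_list_distinct_conv_sum_set flip: atLeast0LessThan)
    qed
    \<comment> \<open>The padding only adds copies of \<open>g 0\<close>, which is
      nonnegative.\<close>
    also have "\<dots> \<le> sum_list (map g xs)"
      using g[OF \<open>0 < m\<close>] by (simp add: xs_def sum_list_replicate)
    also have "\<dots> = (\<Sum>i<N. g (xs ! i))"
      by (simp add: sum_list_sum_nth length_xs atLeast0LessThan)
    also have "\<dots> = (\<Sum>j=1..N. g (\<sigma> j))"
      by (rule sum.reindex_bij_witness[of _ "\<lambda>j. j - 1" Suc]) (auto simp: \<sigma>_def)
    finally show "real N * (\<Sum>i<m. w i * g i) - real m * M \<le> (\<Sum>j=1..N. g (\<sigma> j))"
      by (simp add: sum_subtractf sum_distrib_left)
  qed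
qed

text \<open>Moving the mass of each cell of radius \<open>\<delta>\<close> to its centre costs at
  most \<open>L * \<delta>\<close>, hence at most \<open>\<epsilon> / 2\<close>, at every
  \<open>x\<close>. Rounding the masses to multiples of \<open>1 / N\<close> costs at most
  \<open>m * M / N\<close>, which is within the other half for large \<open>N\<close>.\<close>

lemma Lipschitz_potential_discretization:
  fixes A :: "'a::euclidean_space set" and k :: "real \<Rightarrow> real"
  assumes "compact A" and \<mu>: "prob_space \<mu>" "sets \<mu> = sets borel" "AE x in \<mu>. x \<in> A"
    and lip: "\<And>s t. \<bar>k s - k t\<bar> \<le> L * \<bar>s - t\<bar>"
    and bound: "\<And>t. 0 \<le> t \<Longrightarrow> 0 \<le> k t \<and> k t \<le> M"
    and "\<epsilon> > 0"
  shows "\<forall>\<^sub>F N in sequentially. \<exists>\<omega>\<in>configurations A N. \<forall>x.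
    (\<integral>y. k (norm (x - y)) \<partial>\<mu>) - \<epsilon> \<le> (\<Sum>j=1..N. k (norm (x - \<omega> j))) / real N"
proof -
  interpret prob_space \<mu> by fact
  note [measurable_cong] = \<mu>(2)
  have "L \<ge> 0"
    using lip[of 1 0] by simp
  \<comment> \<open>The summand 1 in the denominator covers the case \<open>L = 0\<close>.\<close>
  define \<delta> where "\<delta> = \<epsilon> / (2 * (L + 1))"
  have "\<delta> > 0"
    using \<open>\<epsilon> > 0\<close> \<open>L \<ge> 0\<close> by (simp add: \<delta>_def)
  have "L * \<delta> \<le> \<epsilon> / 2"
    using \<open>\<epsilon> > 0\<close> \<open>L \<ge> 0\<close> by (simp add: \<delta>_def field_simps)
  have "A \<subseteq> (\<Union>a\<in>A. ball a \<delta>)"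
    using \<open>\<delta> > 0\<close> by auto
  then obtain C where C: "C \<subseteq> A" "finite C" "A \<subseteq> (\<Union>a\<in>C. ball a \<delta>)"
    by (rule compactE_image[OF \<open>compact A\<close>, rotated]) auto
  obtain c where c: "bij_betw c {0..<card C} C"
    using ex_bij_betw_nat_finite[OF C(2)] by blast
  define m where "m = card C"
  have c_in: "c i \<in> A" if "i < m" for i
    using c C(1) that by (auto simp: bij_betw_def m_def)
  have C_eq: "C = c ` {0..<m}"
    using c by (simp add: bij_betw_def m_def)
  \<comment> \<open>The cells are made disjoint so that their masses add up to at most 1.\<close>
  define D where "D = disjointed (\<lambda>i. ball (c i) \<delta>)"
  have [measurable]: "D i \<in> sets borel" for i
    unfolding D_def disjointed_def by measurable
  have D_ball: "D i \<subseteq> ball (c i) \<delta>" for i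
    unfolding D_def by (rule disjointed_subset)
  have D_cover: "\<exists>i<m. y \<in> D i" if "y \<in> A" for y
  proof -
    have "y \<in> (\<Union>i\<in>{0..<m}. ball (c i) \<delta>)"
      using C(3) that unfolding C_eq by blast
    then have "y \<in> (\<Union>i\<in>{0..<m}. D i)"
      unfolding D_def by (simp only: finite_UN_disjointed_eq)
    then show ?thesis
      by auto
  qed
  have "m > 0"
  proof (rule ccontr)
    assume "\<not> m > 0"
    then have "A = {}"
      using D_cover by auto
    then show False
      using \<mu>(3) AE_False by (cases "A = {}") auto
  qed
  define w where "w i = measure \<mu> (D i)" for i
  have "disjoint_family_on D {..<m}"
    unfolding D_def by (rule disjoint_family_on_mono[OF _ disjoint_family_disjointed]) simp
  then have "(\<Sum>i<m. w i) = measure \<mu> (\<Union>i<m. D i)"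
    unfolding w_def by (intro finite_measure_finite_Union[symmetric]) auto
  then have sum_w: "(\<Sum>i<m. w i) \<le> 1"
    by simp
  note u = Lipschitz_potential[OF \<mu>(1,2) lip bound]
  have int_D: "integrable \<mu> (\<lambda>y. indicator (D i) y * a)" for i and a :: real
    by (intro integrable_mult_left integrable_real_indicator) (auto simp: emeasure_eq_measure)
  have step: "(\<integral>y. k (norm (x - y)) \<partial>\<mu>) \<le> (\<Sum>i<m. w i * k (norm (x - c i))) + \<epsilon> / 2" for x
  proof -
    have "(\<integral>y. k (norm (x - y)) \<partial>\<mu>) \<le>
        (\<integral>y. (\<Sum>i<m. indicator (D i) y * k (norm (x - c i))) + \<epsilon> / 2 \<partial>\<mu>)"
    proof (rule integral_mono_AE)
      show "integrable \<mu> (\<lambda>y. (\<Sum>i<m. indicator (D i) y * k (norm (x - c i))) + \<epsilon> / 2)"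
        by (intro Bochner_Integration.integrable_add Bochner_Integration.integrable_sum
            integrable_const int_D)
      show "AE y in \<mu>. k (norm (x - y)) \<le> (\<Sum>i<m. indicator (D i) y * k (norm (x - c i))) + \<epsilon> / 2"
        using \<mu>(3)
      proof eventually_elim
        case (elim y)
        then obtain i where i: "i < m" "y \<in> D i"
          using D_cover by blast
        have "\<bar>norm (x - y) - norm (x - c i)\<bar> \<le> norm (c i - y)"
          using norm_triangle_ineq3[of "x - y" "x - c i"] by simp
        also have "\<dots> \<le> \<delta>"
          using i(2) D_ball[of i] by (auto simp: dist_norm)
        finally have "L * \<bar>norm (x - y) - norm (x - c i)\<bar> \<le> L * \<delta>"
          using \<open>L \<ge> 0\<close> by (rule mult_left_mono)
        then have "k (norm (x - y)) \<le> k (norm (x - c i)) + \<epsilon> / 2"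
          using lip[of "norm (x - y)" "norm (x - c i)"] \<open>L * \<delta> \<le> \<epsilon> / 2\<close> by linarith
        also have "k (norm (x - c i)) = indicator (D i) y * k (norm (x - c i))"
          using i(2) by simp
        also have "\<dots> \<le> (\<Sum>i<m. indicator (D i) y * k (norm (x - c i)))"
          using i(1) bound by (intro member_le_sum) auto
        finally show ?case by simp
      qed
    qed (rule u(1))
    also have "\<dots> = (\<Sum>i<m. w i * k (norm (x - c i))) + \<epsilon> / 2"
      unfolding Bochner_Integration.integral_add[OF Bochner_Integration.integrable_sum[OF int_D] integrable_const]
        Bochner_Integration.integral_sum[OF int_D]
      by (simp add: w_def prob_space)
    finally show ?thesis .
  qed
  \<comment> \<open>From this size on, the rounding error \<open>m * M / N\<close> is at most
    \<open>\<epsilon> / 2\<close>.\<close>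
  obtain N0 :: nat where N0: "2 * real m * M / \<epsilon> \<le> real N0"
    using real_arch_simple by blast
  show ?thesis
  proof (rule eventually_sequentiallyI[of "max 1 N0"])
    fix N assume "max 1 N0 \<le> N"
    then have N: "N \<ge> 1" "2 * real m * M / \<epsilon> \<le> real N"
      using N0 by auto
    obtain \<sigma> :: "nat \<Rightarrow> nat" where \<sigma>: "\<And>j. \<sigma> j < m"
      "\<And>g M. (\<And>i. i < m \<Longrightarrow> 0 \<le> g i \<and> g i \<le> M) \<Longrightarrow>
        real N * (\<Sum>i<m. w i * g i) - real m * M \<le> (\<Sum>j=1..N. g (\<sigma> j))"
      by (rule weights_approximated_by_counts[OF \<open>m > 0\<close> _ sum_w]) (auto simp: w_def)
    \<comment> \<open>Members of \<open>configurations\<close> are extensional functions, hence the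
      restriction to \<open>{1..N}\<close>.\<close>
    define \<omega> where "\<omega> = (\<lambda>j\<in>{1..N}. c (\<sigma> j))"
    have "\<omega> \<in> configurations A N"
      using \<sigma>(1) c_in by (auto simp: \<omega>_def configurations_def)
    moreover have "(\<integral>y. k (norm (x - y)) \<partial>\<mu>) - \<epsilon> \<le> (\<Sum>j=1..N. k (norm (x - \<omega> j))) / real N" for x
    proof -
      have "real N * ((\<integral>y. k (norm (x - y)) \<partial>\<mu>) - \<epsilon>) \<le>
          real N * ((\<Sum>i<m. w i * k (norm (x - c i))) - \<epsilon> / 2)"
        using step[of x] by (intro mult_left_mono) auto
      also have "\<dots> \<le> real N * (\<Sum>i<m. w i * k (norm (x - c i))) - real m * M"
        using N(2) \<open>\<epsilon> > 0\<close> by (simp add: field_simps)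
      also have "\<dots> \<le> (\<Sum>j=1..N. k (norm (x - c (\<sigma> j))))"
        using bound by (intro \<sigma>(2)) auto
      also have "\<dots> = (\<Sum>j=1..N. k (norm (x - \<omega> j)))"
        by (simp add: \<omega>_def)
      finally show ?thesis
        using N(1) by (simp add: pos_le_divide_eq mult.commute)
    qed
    ultimately show "\<exists>\<omega>\<in>configurations A N. \<forall>x.
        (\<integral>y. k (norm (x - y)) \<partial>\<mu>) - \<epsilon> \<le> (\<Sum>j=1..N. k (norm (x - \<omega> j))) / real N"
      by blast
  qed
qed

subsection \<open>Potentials and polarization\<close>

lemma counting_measure_in_prob_measures_on:
  fixes A :: "'a::euclidean_space set"
  assumes "closed A" "N > 0" "\<omega> \<in> configurations A N"
  shows "counting_measure N \<omega> \<in> prob_measures_on A"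
proof -
  have "prob_space (uniform_count_measure {1..N})"
    using \<open>N > 0\<close> by (intro prob_space_uniform_count_measure) auto
  moreover have meas: "\<omega> \<in> measurable (uniform_count_measure {1..N}) borel"
    by (auto simp: measurable_def sets_uniform_count_measure space_uniform_count_measure)
  ultimately have "prob_space (counting_measure N \<omega>)"
    unfolding counting_measure_def by (rule prob_space.prob_space_distr)
  moreover have "AE x in counting_measure N \<omega>. x \<in> A"
  proof -
    have "AE j in uniform_count_measure {1..N}. \<omega> j \<in> A"
      using assms(3) by (intro AE_I2) (auto simp: space_uniform_count_measure configurations_def)
    then show ?thesis
      unfolding counting_measure_def using meas assms(1)
      by (subst AE_distr_iff) (auto simp: borel_closed)
  qed
  ultimately show ?thesis
    unfolding prob_measures_on_iff[OF assms(1)] by (simp add: counting_measure_def)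
qed

locale lsc_radial_kernel =
  fixes A :: "'a::euclidean_space set" and f :: "real \<Rightarrow> ennreal" and K :: "'a \<Rightarrow> 'a \<Rightarrow> ennreal"
  assumes compact_A: "compact A"
    and lsc_f: "lower_semicontinuous_on {0..} f"
    and K_eq: "\<And>x y. x \<in> A \<Longrightarrow> y \<in> A \<Longrightarrow> K x y = f (norm (x - y))"
begin

text \<open>Written with \<open>f\<close> and without restriction to \<open>A\<close>, so that it is
  free of indicators and given by one formula at every point; for measures on \<open>A\<close> it
  agrees with \<open>potential\<close> on \<open>A\<close>.\<close>

definition U :: "'a measure \<Rightarrow> 'a \<Rightarrow> ennreal" where
  "U \<nu> x = (\<integral>\<^sup>+y. f (norm (x - y)) \<partial>\<nu>)"

lemma closed_A: "closed A"
  using compact_A by (rule compact_imp_closed)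

lemmas prob_measures_on_A = prob_measures_on_iff[OF closed_A]

lemma kernel_measurable:
  "(\<lambda>(x, y :: 'a). f (norm (x - y))) \<in> borel_measurable (borel \<Otimes>\<^sub>M borel)"
proof -
  \<comment> \<open>\<open>f\<close> is unconstrained on negative reals, so measurability is
    obtained for the even function \<open>f \<bar>t\<bar>\<close>, which has the same values at
    norms.\<close>
  have [measurable]: "(\<lambda>t :: real. f \<bar>t\<bar>) \<in> borel_measurable borel"
    using lsc_kernel_measurable[OF lsc_f, of "0 :: real"] by simp
  have "(\<lambda>(x, y :: 'a). f \<bar>norm (x - y)\<bar>) \<in> borel_measurable (borel \<Otimes>\<^sub>M borel)"
    by measurable
  then show ?thesis
    by simp
qed

lemma potential_eq_U:
  assumes "\<nu> \<in> prob_measures_on A" "x \<in> A"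
  shows "potential A K \<nu> x = U \<nu> x"
proof -
  have "AE y in \<nu>. y \<in> A"
    using assms prob_measures_on_A by auto
  then show ?thesis
    unfolding potential_def U_def
    by (intro nn_integral_cong_AE) (auto elim!: eventually_mono simp: K_eq assms(2))
qed

lemma energy_eq_U:
  assumes \<nu>: "\<nu> \<in> prob_measures_on A"
  shows "energy A K \<nu> = (\<integral>\<^sup>+x. U \<nu> x \<partial>\<nu>)"
proof -
  have A: "AE y in \<nu>. y \<in> A"
    using assms prob_measures_on_A by auto
  have "(\<integral>\<^sup>+x\<in>A. K x y \<partial>\<nu>) = U \<nu> y" if "y \<in> A" for y
    unfolding U_def using A
    by (intro nn_integral_cong_AE)
       (auto elim!: eventually_mono simp: K_eq that norm_minus_commute)
  with A show ?thesis
    unfolding energy_def by (intro nn_integral_cong_AE) (auto elim!: eventually_mono)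
qed

text \<open>Tonelli's theorem together with the symmetry of the distance.\<close>

lemma nn_integral_U_commute:
  assumes "\<mu> \<in> prob_measures_on A" "\<nu> \<in> prob_measures_on A"
  shows "(\<integral>\<^sup>+x. U \<nu> x \<partial>\<mu>) = (\<integral>\<^sup>+y. U \<mu> y \<partial>\<nu>)"
proof -
  interpret \<mu>: prob_space \<mu>
    using assms prob_measures_on_A by auto
  interpret \<nu>: prob_space \<nu>
    using assms prob_measures_on_A by auto
  interpret pair_sigma_finite \<mu> \<nu> ..
  have "sets (\<mu> \<Otimes>\<^sub>M \<nu>) = sets (borel \<Otimes>\<^sub>M borel)"
    using assms prob_measures_on_A by (intro sets_pair_measure_cong) auto
  then have "(\<lambda>(x, y). f (norm (x - y))) \<in> borel_measurable (\<mu> \<Otimes>\<^sub>M \<nu>)"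
    using kernel_measurable by (simp cong: measurable_cong_sets)
  from Fubini'[OF this] show ?thesis
    unfolding U_def by (simp add: norm_minus_commute)
qed

lemma polarization_eq_INF_U:
  assumes "N > 0" "\<omega> \<in> configurations A N"
  shows "polarization A K N \<omega> = (INF x\<in>A. U (counting_measure N \<omega>) x)"
  unfolding polarization_def
  using potential_counting_measure[OF compact_A lsc_f K_eq assms]
    potential_eq_U[OF counting_measure_in_prob_measures_on[OF closed_A assms]]
  by (intro INF_cong) auto

text \<open>Monotone convergence carries the approximation of the kernel over to potentials:
  \<open>U \<nu>\<close> is an increasing supremum of Lipschitz functions whose constants do not
  depend on \<open>\<nu>\<close>.\<close>

lemma Lipschitz_minorants:
  obtains k :: "nat \<Rightarrow> real \<Rightarrow> real" where
    "\<And>m s t. \<bar>k m s - k m t\<bar> \<le> real m * \<bar>s - t\<bar>"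
    "\<And>m t. 0 \<le> t \<Longrightarrow> 0 \<le> k m t \<and> k m t \<le> real m"
    "\<And>m t. 0 \<le> t \<Longrightarrow> ennreal (k m t) \<le> f t"
    "\<And>\<nu> x m n. \<nu> \<in> prob_measures_on A \<Longrightarrow> m \<le> n \<Longrightarrow>
      (\<integral>y. k m (norm (x - y)) \<partial>\<nu>) \<le> (\<integral>y. k n (norm (x - y)) \<partial>\<nu>)"
    "\<And>\<nu> x. \<nu> \<in> prob_measures_on A \<Longrightarrow>
      (SUP m. ennreal (\<integral>y. k m (norm (x - y)) \<partial>\<nu>)) = U \<nu> x"
proof -
  obtain k :: "nat \<Rightarrow> real \<Rightarrow> real" where
    lip: "\<And>m s t. \<bar>k m s - k m t\<bar> \<le> real m * \<bar>s - t\<bar>" and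
    bound: "\<And>m t. 0 \<le> t \<Longrightarrow> 0 \<le> k m t \<and> k m t \<le> real m" and
    mono: "\<And>m n t. m \<le> n \<Longrightarrow> k m t \<le> k n t" and
    SUP: "\<And>t. 0 \<le> t \<Longrightarrow> (SUP m. ennreal (k m t)) = f t"
    using lower_semicontinuous_SUP_Lipschitz[OF lsc_f] by metis
  have int: "integrable \<nu> (\<lambda>y. k m (norm (x - y)))" if "\<nu> \<in> prob_measures_on A" for \<nu> m x
    using Lipschitz_potential(1)[OF _ _ lip bound] that prob_measures_on_A by auto
  show thesis
  proof
    show "ennreal (k m t) \<le> f t" if "0 \<le> t" for m t
      unfolding SUP[OF that, symmetric] by (rule SUP_upper) simp
    fix \<nu> x assume \<nu>: "\<nu> \<in> prob_measures_on A"
    show "(\<integral>y. k m (norm (x - y)) \<partial>\<nu>) \<le> (\<integral>y. k n (norm (x - y)) \<partial>\<nu>)" if "m \<le> n" for m n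
      by (intro integral_mono int \<nu> mono that)
    have "ennreal (\<integral>y. k m (norm (x - y)) \<partial>\<nu>) = (\<integral>\<^sup>+y. ennreal (k m (norm (x - y))) \<partial>\<nu>)" for m
      using int[OF \<nu>] bound by (intro nn_integral_eq_integral[symmetric]) auto
    moreover have "(\<integral>\<^sup>+y. (SUP m. ennreal (k m (norm (x - y)))) \<partial>\<nu>) =
        (SUP m. \<integral>\<^sup>+y. ennreal (k m (norm (x - y))) \<partial>\<nu>)"
      using borel_measurable_integrable[OF int[OF \<nu>]] mono
      by (intro nn_integral_monotone_convergence_SUP)
         (auto simp: incseq_def le_fun_def intro!: ennreal_leI)
    ultimately show "(SUP m. ennreal (\<integral>y. k m (norm (x - y)) \<partial>\<nu>)) = U \<nu> x"
      by (simp add: U_def SUP)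
  qed (fact lip bound)+
qed

lemma set_integral_eq_integral:
  fixes g :: "'a \<Rightarrow> real"
  assumes "\<nu> \<in> prob_measures_on A" "g \<in> borel_measurable borel"
  shows "(\<integral>x\<in>A. g x \<partial>\<nu>) = (\<integral>x. g x \<partial>\<nu>)"
proof -
  have [measurable_cong]: "sets \<nu> = sets borel" and AE: "AE x in \<nu>. x \<in> A"
    using assms prob_measures_on_A by auto
  note [measurable] = borel_closed[OF closed_A] assms(2)
  show ?thesis
    unfolding set_lebesgue_integral_def using AE
    by (intro integral_cong_AE) (auto elim!: eventually_mono)
qed

end

section \<open>Consequences of a constant equilibrium potential\<close>

locale constant_equilibrium_potential = lsc_radial_kernel A f K
  for A :: "'a::euclidean_space set" and f :: "real \<Rightarrow> ennreal" and K :: "'a \<Rightarrow> 'a \<Rightarrow> ennreal" +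
  fixes \<mu> :: "'a measure" and W :: real
  assumes A2: "\<exists>!\<mu>. equilibrium_measure A K \<mu>" "equilibrium_measure A K \<mu>"
    and A3: "measure_support \<mu> = A"
    and A4: "0 < W" "\<And>x. x \<in> A \<Longrightarrow> potential A K \<mu> x = ennreal W"
begin

lemma \<mu>: "\<mu> \<in> prob_measures_on A" "sets \<mu> = sets borel" "prob_space \<mu>" "AE x in \<mu>. x \<in> A"
  using A2(2) prob_measures_on_A by (auto simp: equilibrium_measure_def)

sublocale \<mu>: prob_space \<mu>
  by (rule \<mu>)

lemma A_nonempty: "A \<noteq> {}"
  using \<mu>(4) \<mu>.AE_False by (cases "A = {}") auto

lemma U_eq_W: "x \<in> A \<Longrightarrow> U \<mu> x = ennreal W"
  using potential_eq_U \<mu>(1) A4(2) by metis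

text \<open>Exchanging the two measures turns the integrand into \<open>U \<mu>\<close>, which
  equals \<open>W\<close> almost everywhere for \<open>\<nu>\<close>.\<close>

lemma integral_U_eq_W:
  assumes "\<nu> \<in> prob_measures_on A"
  shows "(\<integral>\<^sup>+x. U \<nu> x \<partial>\<mu>) = ennreal W"
proof -
  have \<nu>: "AE x in \<nu>. x \<in> A" "prob_space \<nu>"
    using assms prob_measures_on_A by auto
  have "(\<integral>\<^sup>+y. U \<mu> y \<partial>\<nu>) = (\<integral>\<^sup>+y. ennreal W \<partial>\<nu>)"
    using \<nu>(1) by (intro nn_integral_cong_AE) (auto elim!: eventually_mono simp: U_eq_W)
  then show ?thesis
    using nn_integral_U_commute[OF \<mu>(1) assms] prob_space.emeasure_space_1[OF \<nu>(2)] by simp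
qed

text \<open>An infimum over \<open>A\<close> cannot exceed the mean against a probability measure on
  \<open>A\<close>.\<close>

lemma INF_U_le_W:
  assumes "\<nu> \<in> prob_measures_on A"
  shows "(INF x\<in>A. U \<nu> x) \<le> ennreal W"
proof -
  have "(INF x\<in>A. U \<nu> x) = (\<integral>\<^sup>+x. (INF x\<in>A. U \<nu> x) \<partial>\<mu>)"
    by (simp add: \<mu>.emeasure_space_1)
  also have "\<dots> \<le> (\<integral>\<^sup>+x. U \<nu> x \<partial>\<mu>)"
    using \<mu>(4) by (intro nn_integral_mono_AE) (auto elim!: eventually_mono intro: INF_lower)
  finally show ?thesis
    using integral_U_eq_W[OF assms] by simp
qed

text \<open>Integrating the bound against \<open>\<nu>\<close> gives energy at most
  \<open>W\<close>, which is the energy of \<open>\<mu>\<close> and hence the minimum; uniqueness of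
  the equilibrium measure concludes.\<close>

lemma eq_\<mu>_if_U_le_W:
  assumes \<nu>: "\<nu> \<in> prob_measures_on A" and le: "\<And>x. x \<in> A \<Longrightarrow> U \<nu> x \<le> ennreal W"
  shows "\<nu> = \<mu>"
proof -
  have \<nu>': "AE x in \<nu>. x \<in> A" "prob_space \<nu>"
    using \<nu> prob_measures_on_A by auto
  have "energy A K \<nu> \<le> (\<integral>\<^sup>+x. ennreal W \<partial>\<nu>)"
    unfolding energy_eq_U[OF \<nu>]
    using \<nu>'(1) by (intro nn_integral_mono_AE) (auto elim!: eventually_mono intro: le)
  also have "\<dots> = energy A K \<mu>"
    using integral_U_eq_W[OF \<mu>(1)] prob_space.emeasure_space_1[OF \<nu>'(2)]
    by (simp add: energy_eq_U[OF \<mu>(1)])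
  also have "\<dots> = (INF \<nu>\<in>prob_measures_on A. energy A K \<nu>)"
    using A2(2) by (simp add: equilibrium_measure_def)
  finally have "equilibrium_measure A K \<nu>"
    using \<nu> by (auto simp: equilibrium_measure_def intro!: antisym INF_lower)
  then show ?thesis
    using A2 by blast
qed

text \<open>Full support enters here: an excess of a potential around any single point of
  \<open>A\<close> becomes visible in its \<open>\<mu>\<close>-mean.\<close>

lemma ball_measure_pos:
  assumes "x \<in> A" "r > 0"
  shows "0 < measure \<mu> (ball x r)"
proof -
  have "0 < emeasure \<mu> (ball x r)"
    using assms A3 by (auto simp: measure_support_def)
  then show ?thesis
    by (simp add: \<mu>.emeasure_eq_measure)
qed

text \<open>The \<open>\<mu>\<close>-mean of each \<open>U (\<nu> n)\<close> is \<open>W\<close> and its infimum tends to \<open>W\<close>, so \<open>U (\<nu> n)\<close> cannot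
  eventually exceed \<open>W\<close> by a fixed amount on a ball around a point of the support of \<open>\<mu>\<close>.\<close>

lemma weak_limit_eq_\<mu>:
  assumes \<nu>n: "\<And>n. \<nu>n n \<in> prob_measures_on A" and \<nu>: "\<nu> \<in> prob_measures_on A"
    and weak: "weakly_converges_on A \<nu>n \<nu>"
    and INF: "(\<lambda>n. INF x\<in>A. U (\<nu>n n) x) \<longlonglongrightarrow> ennreal W"
  shows "\<nu> = \<mu>"
proof (rule eq_\<mu>_if_U_le_W[OF \<nu>], rule ccontr)
  fix x0 assume "x0 \<in> A" and "\<not> U \<nu> x0 \<le> ennreal W"
  obtain k :: "nat \<Rightarrow> real \<Rightarrow> real" where
    lip: "\<And>m s t. \<bar>k m s - k m t\<bar> \<le> real m * \<bar>s - t\<bar>" and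
    bound: "\<And>m t. 0 \<le> t \<Longrightarrow> 0 \<le> k m t \<and> k m t \<le> real m" and
    U_SUP: "\<And>\<nu> x. \<nu> \<in> prob_measures_on A \<Longrightarrow>
      (SUP m. ennreal (\<integral>y. k m (norm (x - y)) \<partial>\<nu>)) = U \<nu> x"
    using Lipschitz_minorants by metis
  define u where "u m \<tau> x = (\<integral>y. k m (norm (x - y)) \<partial>\<tau>)" for m \<tau> and x :: 'a
  have u_le_U: "ennreal (u m \<tau> x) \<le> U \<tau> x" if "\<tau> \<in> prob_measures_on A" for m \<tau> x
    unfolding u_def U_SUP[OF that, symmetric] by (rule SUP_upper) simp
  obtain m where "ennreal W < ennreal (u m \<nu> x0)"
    using \<open>\<not> U \<nu> x0 \<le> ennreal W\<close> unfolding u_def U_SUP[OF \<nu>, symmetric]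
    by (auto simp: not_le less_SUP_iff)
  then have "W < u m \<nu> x0"
    using A4(1) by (simp add: ennreal_less_iff)
  \<comment> \<open>With \<open>u m \<nu> x0 = W + 3 * \<epsilon>\<close>, passing to
    \<open>\<nu>n n\<close> costs one \<open>\<epsilon>\<close> and moving from \<open>x0\<close>
    within the ball \<open>B\<close> another, leaving an excess of
    \<open>\<epsilon>\<close>.\<close>
  define \<epsilon> where "\<epsilon> = (u m \<nu> x0 - W) / 3"
  have "\<epsilon> > 0"
    using \<open>W < u m \<nu> x0\<close> by (simp add: \<epsilon>_def)
  \<comment> \<open>On this ball a function with Lipschitz constant \<open>real m\<close> differs
    from its value at \<open>x0\<close> by at most \<open>\<epsilon>\<close>, also when
    \<open>m = 0\<close>.\<close>
  define B where "B = ball x0 (\<epsilon> / (real m + 1))"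
  define p where "p = measure \<mu> B"
  have "p > 0"
    unfolding p_def B_def using \<open>\<epsilon> > 0\<close> by (intro ball_measure_pos \<open>x0 \<in> A\<close>) auto
  \<comment> \<open>The bound by \<open>W\<close> keeps \<open>W - \<eta>\<close> nonnegative before
    it is cast to \<open>ennreal\<close>; the other bound makes the final inequality
    \<open>(\<epsilon> + \<eta>) * p \<le> \<eta>\<close> impossible.\<close>
  define \<eta> where "\<eta> = min W (\<epsilon> * p / 2)"
  have \<eta>: "0 < \<eta>" "\<eta> \<le> W" "\<eta> \<le> \<epsilon> * p / 2"
    using A4(1) \<open>\<epsilon> > 0\<close> \<open>p > 0\<close> by (auto simp: \<eta>_def)
  have pm: "prob_space \<tau>" "sets \<tau> = sets borel" if "\<tau> \<in> prob_measures_on A" for \<tau>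
    using that prob_measures_on_A by auto
  have cont: "continuous_on S (\<lambda>y. k m (norm (x0 - y)))" for S
    by (rule Lipschitz_potential(3)[OF pm[OF \<nu>] lip bound])
  have "u m \<tau> x0 = (\<integral>y\<in>A. k m (norm (x0 - y)) \<partial>\<tau>)" if "\<tau> \<in> prob_measures_on A" for \<tau>
    unfolding u_def
    using set_integral_eq_integral[OF that borel_measurable_continuous_onI[OF cont]] by simp
  then have "(\<lambda>n. u m (\<nu>n n) x0) \<longlonglongrightarrow> u m \<nu> x0"
    using weak cont[of A] \<nu>n \<nu> unfolding weakly_converges_on_def by simp
  then have "\<forall>\<^sub>F n in sequentially. W + 2 * \<epsilon> < u m (\<nu>n n) x0"
    using \<open>\<epsilon> > 0\<close> by (rule_tac order_tendstoD(1)) (auto simp: \<epsilon>_def field_simps)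
  moreover have "\<forall>\<^sub>F n in sequentially. ennreal (W - \<eta>) < (INF x\<in>A. U (\<nu>n n) x)"
    using INF by (rule order_tendstoD) (use A4(1) \<eta>(1) in \<open>simp add: ennreal_lessI\<close>)
  ultimately obtain n where n: "W + 2 * \<epsilon> < u m (\<nu>n n) x0"
      "ennreal (W - \<eta>) < (INF x\<in>A. U (\<nu>n n) x)"
    using eventually_happens'[OF _ eventually_conj] by force
  have [measurable]: "B \<in> sets \<mu>"
    using \<mu>(2) by (simp add: B_def)
  have emeasure_B: "emeasure \<mu> B = ennreal p"
    by (simp add: p_def \<mu>.emeasure_eq_measure)
  \<comment> \<open>This is the \<open>\<mu>\<close>-mean of a step function below
    \<open>U (\<nu>n n)\<close>: \<open>W - \<eta>\<close> off \<open>B\<close>, from the infimum,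
    and \<open>W + \<epsilon>\<close> on \<open>B\<close>.\<close>
  have "ennreal (W - \<eta> + (\<epsilon> + \<eta>) * p) = ennreal (W - \<eta>) + ennreal (\<epsilon> + \<eta>) * ennreal p"
    using \<eta> \<open>\<epsilon> > 0\<close> \<open>p > 0\<close> by (simp add: ennreal_mult)
  also have "\<dots> = (\<integral>\<^sup>+x. ennreal (W - \<eta>) + ennreal (\<epsilon> + \<eta>) * indicator B x \<partial>\<mu>)"
    by (simp add: nn_integral_add nn_integral_cmult \<mu>.emeasure_space_1 emeasure_B)
  also have "\<dots> \<le> (\<integral>\<^sup>+x. U (\<nu>n n) x \<partial>\<mu>)"
  proof (rule nn_integral_mono_AE, use \<mu>(4) in eventually_elim)
    case (elim x)
    show ?case
    proof (cases "x \<in> B")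
      case True
      have "\<bar>u m (\<nu>n n) x0 - u m (\<nu>n n) x\<bar> \<le> real m * norm (x0 - x)"
        unfolding u_def by (rule Lipschitz_potential(2)[OF pm[OF \<nu>n] lip bound])
      also have "\<dots> \<le> real m * (\<epsilon> / (real m + 1))"
        using True by (intro mult_left_mono) (auto simp: B_def dist_norm)
      also have "\<dots> \<le> \<epsilon>"
        using \<open>\<epsilon> > 0\<close> by (simp add: field_simps)
      finally have "W + \<epsilon> \<le> u m (\<nu>n n) x"
        using n(1) by linarith
      then have "ennreal (W + \<epsilon>) \<le> U (\<nu>n n) x"
        using u_le_U[OF \<nu>n] by (meson ennreal_leI order_trans)
      then show ?thesis
        using True \<eta> \<open>\<epsilon> > 0\<close> by (simp flip: ennreal_plus)
    next
      case False
      then show ?thesis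
        using n(2) INF_lower[OF elim, of "U (\<nu>n n)"] by (auto dest: less_imp_le intro: order_trans)
    qed
  qed
  also have "\<dots> = ennreal W"
    by (rule integral_U_eq_W[OF \<nu>n])
  finally have "(\<epsilon> + \<eta>) * p \<le> \<eta>"
    using A4(1) by simp
  moreover have "\<epsilon> * p > 0" "\<eta> * p > 0"
    using \<open>\<epsilon> > 0\<close> \<open>p > 0\<close> \<eta>(1) by simp_all
  ultimately show False
    using \<eta>(3) by (simp add: distrib_right)
qed

text \<open>If convergence fails for some \<open>g\<close>, a subsequence keeps its integrals away
  from the one for \<open>\<mu>\<close>. Weak compactness gives a further subsequence with a limit,
  which must be \<open>\<mu>\<close>, a contradiction.\<close>

lemma weakly_converges_to_\<mu>:
  assumes \<nu>: "\<And>n. \<nu> n \<in> prob_measures_on A"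
    and INF: "(\<lambda>n. INF x\<in>A. U (\<nu> n) x) \<longlonglongrightarrow> ennreal W"
  shows "weakly_converges_on A \<nu> \<mu>"
  unfolding weakly_converges_on_def
proof (intro allI impI, rule ccontr)
  fix g :: "'a \<Rightarrow> real" assume g: "continuous_on A g"
  define I where "I \<tau> = (\<integral>x\<in>A. g x \<partial>\<tau>)" for \<tau>
  assume "\<not> (\<lambda>n. \<integral>x\<in>A. g x \<partial>\<nu> n) \<longlonglongrightarrow> (\<integral>x\<in>A. g x \<partial>\<mu>)"
  then obtain e where "e > 0" "\<not> (\<forall>\<^sub>F n in sequentially. dist (I (\<nu> n)) (I \<mu>) < e)"
    unfolding I_def tendsto_iff by blast
  then obtain s where s: "strict_mono (s :: nat \<Rightarrow> nat)" "\<And>n. \<not> dist (I (\<nu> (s n))) (I \<mu>) < e"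
    using not_eventually_sequentiallyD by blast
  obtain r \<tau> where r: "strict_mono (r :: nat \<Rightarrow> nat)" "\<tau> \<in> prob_measures_on A"
      "weakly_converges_on A (\<lambda>n. \<nu> (s (r n))) \<tau>"
    using prob_measures_on_compact_subseq[OF compact_A, of "\<lambda>n. \<nu> (s n)"] \<nu> by blast
  have "(\<lambda>n. INF x\<in>A. U (\<nu> (s (r n))) x) \<longlonglongrightarrow> ennreal W"
    using LIMSEQ_subseq_LIMSEQ[OF INF strict_mono_o[OF s(1) r(1)]] by (simp add: o_def)
  then have "\<tau> = \<mu>"
    by (intro weak_limit_eq_\<mu>[OF _ r(2,3)] \<nu>)
  then have "(\<lambda>n. I (\<nu> (s (r n)))) \<longlonglongrightarrow> I \<mu>"
    using r(3) g unfolding weakly_converges_on_def I_def by blast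
  from tendstoD[OF this \<open>e > 0\<close>] show False
    using s(2) eventually_happens'[OF sequentially_bot] by blast
qed

lemma max_polarization_le_W:
  assumes "N > 0"
  shows "max_polarization A K N \<le> ennreal W"
  unfolding max_polarization_def
  using INF_U_le_W counting_measure_in_prob_measures_on[OF closed_A assms]
  by (intro SUP_least) (simp add: polarization_eq_INF_U[OF assms])

text \<open>Half of \<open>\<epsilon>\<close> pays for replacing the kernel by a Lipschitz minorant,
  half for discretizing \<open>\<mu>\<close>. If \<open>\<epsilon> > W\<close>, the left side is 0
  in \<open>ennreal\<close>.\<close>

lemma max_polarization_ge:
  assumes "\<epsilon> > 0"
  shows "\<forall>\<^sub>F N in sequentially. ennreal (W - \<epsilon>) \<le> max_polarization A K N"
proof -
  obtain k :: "nat \<Rightarrow> real \<Rightarrow> real" where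
    lip: "\<And>m s t. \<bar>k m s - k m t\<bar> \<le> real m * \<bar>s - t\<bar>" and
    bound: "\<And>m t. 0 \<le> t \<Longrightarrow> 0 \<le> k m t \<and> k m t \<le> real m" and
    k_le_f: "\<And>m t. 0 \<le> t \<Longrightarrow> ennreal (k m t) \<le> f t" and
    mono: "\<And>\<nu> x m n. \<nu> \<in> prob_measures_on A \<Longrightarrow> m \<le> n \<Longrightarrow>
      (\<integral>y. k m (norm (x - y)) \<partial>\<nu>) \<le> (\<integral>y. k n (norm (x - y)) \<partial>\<nu>)" and
    U_SUP: "\<And>\<nu> x. \<nu> \<in> prob_measures_on A \<Longrightarrow>
      (SUP m. ennreal (\<integral>y. k m (norm (x - y)) \<partial>\<nu>)) = U \<nu> x"
    using Lipschitz_minorants by metis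
  define u where "u m x = (\<integral>y. k m (norm (x - y)) \<partial>\<mu>)" for m and x :: 'a
  define S where "S m = {x. W - \<epsilon> / 2 < u m x}" for m
  have "continuous_on UNIV (u m)" for m
  proof -
    have "(real m)-lipschitz_on UNIV (u m)"
      unfolding u_def
      by (intro lipschitz_onI)
         (auto simp: dist_norm intro!: Lipschitz_potential(2)[OF \<mu>(3,2) lip bound])
    then show ?thesis
      by (rule lipschitz_on_continuous_on)
  qed
  then have open_S: "open (S m)" for m
    unfolding S_def by (intro open_Collect_less continuous_intros)
  \<comment> \<open>On \<open>A\<close> the functions \<open>u m\<close> increase to the constant
    \<open>W\<close>, so each point eventually enters the open sets \<open>S m\<close>.\<close>
  have "A \<subseteq> (\<Union>m. S m)"
  proof
    fix x assume "x \<in> A"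
    have "ennreal (W - \<epsilon> / 2) < (SUP m. ennreal (u m x))"
      unfolding u_def U_SUP[OF \<mu>(1)] U_eq_W[OF \<open>x \<in> A\<close>]
      using A4(1) \<open>\<epsilon> > 0\<close> by (simp add: ennreal_lessI)
    then obtain m where "ennreal (W - \<epsilon> / 2) < ennreal (u m x)"
      by (auto simp: less_SUP_iff)
    then have "x \<in> S m"
      unfolding S_def mem_Collect_eq by (meson ennreal_leI leD not_le)
    then show "x \<in> (\<Union>m. S m)"
      by blast
  qed
  then obtain J where J: "finite J" "A \<subseteq> (\<Union>m\<in>J. S m)"
    by (rule compactE_image[OF compact_A open_S])
  \<comment> \<open>The sets \<open>S m\<close> grow with \<open>m\<close>, so the largest index of
    the finite subcover suffices.\<close>
  have "A \<subseteq> S (Max J)"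
  proof
    fix x assume "x \<in> A"
    then obtain m where "m \<in> J" "x \<in> S m"
      using J(2) by blast
    then show "x \<in> S (Max J)"
      using mono[OF \<mu>(1) Max_ge[OF J(1)], of m x] by (auto simp: S_def u_def)
  qed
  then obtain m where m: "\<And>x. x \<in> A \<Longrightarrow> W - \<epsilon> / 2 < u m x"
    unfolding S_def by blast
  have "\<forall>\<^sub>F N in sequentially. \<exists>\<omega>\<in>configurations A N. \<forall>x.
      u m x - \<epsilon> / 2 \<le> (\<Sum>j=1..N. k m (norm (x - \<omega> j))) / real N"
    unfolding u_def using \<open>\<epsilon> > 0\<close>
    by (intro Lipschitz_potential_discretization[OF compact_A \<mu>(3,2,4) lip bound]) auto
  with eventually_gt_at_top[of 0] show ?thesis
  proof eventually_elim
    case (elim N)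
    then obtain \<omega> where \<omega>: "\<omega> \<in> configurations A N"
        "\<And>x. u m x - \<epsilon> / 2 \<le> (\<Sum>j=1..N. k m (norm (x - \<omega> j))) / real N"
      by blast
    have "ennreal (W - \<epsilon>) \<le> polarization A K N \<omega>"
      unfolding polarization_def
    proof (rule INF_greatest)
      fix x assume "x \<in> A"
      have "ennreal (W - \<epsilon>) \<le> ennreal ((\<Sum>j=1..N. k m (norm (x - \<omega> j))) / real N)"
        using m[OF \<open>x \<in> A\<close>] \<omega>(2)[of x] by (intro ennreal_leI) linarith
      also have "\<dots> = (\<Sum>j=1..N. ennreal (k m (norm (x - \<omega> j)))) / of_nat N"
        using elim(1) bound
        by (simp add: divide_ennreal[symmetric] sum_nonneg ennreal_of_nat_eq_real_of_nat)
      also have "\<dots> \<le> (\<Sum>j=1..N. K x (\<omega> j)) / of_nat N"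
      proof (intro divide_right_mono_ennreal sum_mono)
        fix j assume "j \<in> {1..N}"
        then have "\<omega> j \<in> A"
          using \<omega>(1) unfolding configurations_def by (rule PiE_mem[rotated])
        then show "ennreal (k m (norm (x - \<omega> j))) \<le> K x (\<omega> j)"
          using k_le_f \<open>x \<in> A\<close> by (simp add: K_eq)
      qed
      finally show "ennreal (W - \<epsilon>) \<le> (\<Sum>j=1..N. K x (\<omega> j)) / of_nat N" .
    qed
    also have "\<dots> \<le> max_polarization A K N"
      unfolding max_polarization_def using \<omega>(1) by (rule SUP_upper)
    finally show ?case .
  qed
qed

lemma max_polarization_tendsto: "max_polarization A K \<longlonglongrightarrow> ennreal W"
proof (rule order_tendstoI)
  fix a assume "a < ennreal W"
  then obtain r where r: "0 \<le> r" "a = ennreal r" "r < W"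
    by (cases a) (auto simp: ennreal_less_iff)
  \<comment> \<open>The midpoint of \<open>r\<close> and \<open>W\<close> turns the non-strict lower
    bound into a strict one.\<close>
  have "a < ennreal (W - (W - r) / 2)"
    unfolding r(2) using r(1,3) by (intro ennreal_lessI) (auto simp: field_simps)
  moreover have "\<forall>\<^sub>F N in sequentially. ennreal (W - (W - r) / 2) \<le> max_polarization A K N"
    using r(3) by (intro max_polarization_ge) simp
  ultimately show "\<forall>\<^sub>F N in sequentially. a < max_polarization A K N"
    by (auto elim!: eventually_mono)
next
  fix a assume "ennreal W < a"
  then show "\<forall>\<^sub>F N in sequentially. max_polarization A K N < a"
    using max_polarization_le_W
    by (intro eventually_mono[OF eventually_gt_at_top[of 0]]) (blast intro: le_less_trans)
qed

lemma polarization_optimal_weakly_converges: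
  assumes opt: "\<And>N. N \<ge> 2 \<Longrightarrow> polarization_optimal A K N (\<omega> N)"
  shows "weakly_converges_on A (\<lambda>N. counting_measure N (\<omega> N)) \<mu>"
proof -
  \<comment> \<open>Optimality is only assumed from \<open>N = 2\<close> on; weak convergence of the
    sequence shifted by 2 gives that of the original one.\<close>
  define \<nu> where "\<nu> n = counting_measure (n + 2) (\<omega> (n + 2))" for n
  have conf: "\<omega> (n + 2) \<in> configurations A (n + 2)" for n
    using opt[of "n + 2"] by (simp add: polarization_optimal_def)
  have "\<nu> n \<in> prob_measures_on A" for n
    unfolding \<nu>_def by (rule counting_measure_in_prob_measures_on[OF closed_A _ conf]) simp
  moreover have "(INF x\<in>A. U (\<nu> n) x) = max_polarization A K (n + 2)" for n
    using polarization_eq_INF_U[OF _ conf, of n] opt[of "n + 2"]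
    by (simp add: \<nu>_def polarization_optimal_def)
  ultimately have "weakly_converges_on A \<nu> \<mu>"
    using LIMSEQ_ignore_initial_segment[OF max_polarization_tendsto, of 2]
    by (intro weakly_converges_to_\<mu>) simp_all
  then show ?thesis
    unfolding weakly_converges_on_def \<nu>_def by (blast intro: LIMSEQ_offset)
qed

lemma INF_potential_eq:
  assumes "\<nu> \<in> prob_measures_on A"
  shows "(INF x\<in>A. potential A K \<nu> x) = (INF x\<in>A. U \<nu> x)"
  using potential_eq_U[OF assms] by (intro INF_cong) auto

lemma polarization_extremal_iff: "polarization_extremal A K \<nu> \<longleftrightarrow> \<nu> = \<mu>"
proof -
  have INF_\<mu>: "(INF x\<in>A. potential A K \<mu> x) = ennreal W"
    using A4(2) A_nonempty by simp
  have SUP: "(SUP \<nu>\<in>prob_measures_on A. INF x\<in>A. potential A K \<nu> x) = ennreal W"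
  proof (rule antisym)
    show "(SUP \<nu>\<in>prob_measures_on A. INF x\<in>A. potential A K \<nu> x) \<le> ennreal W"
      by (intro SUP_least) (simp add: INF_potential_eq INF_U_le_W)
    show "ennreal W \<le> (SUP \<nu>\<in>prob_measures_on A. INF x\<in>A. potential A K \<nu> x)"
      using SUP_upper[OF \<mu>(1), of "\<lambda>\<nu>. INF x\<in>A. potential A K \<nu> x"] INF_\<mu> by simp
  qed
  \<comment> \<open>The constant sequence \<open>\<nu>\<close> converges weakly to
    \<open>\<nu>\<close>, so the lemma on weak limits identifies \<open>\<nu>\<close>
    itself.\<close>
  have "\<nu> = \<mu>" if "\<nu> \<in> prob_measures_on A" "(INF x\<in>A. potential A K \<nu> x) = ennreal W"
    using that
    by (intro weak_limit_eq_\<mu>[of "\<lambda>_. \<nu>"]) (simp_all add: weakly_converges_on_def INF_potential_eq)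
  then show ?thesis
    using INF_\<mu> \<mu>(1) unfolding polarization_extremal_def SUP by blast
qed

end

theorem corollary1p2:
  fixes A :: "(real ^ 't) set"
    and f :: "real \<Rightarrow> ennreal"
    and K :: "real ^ 't \<Rightarrow> real ^ 't \<Rightarrow> ennreal"
    and \<mu>\<^sub>e\<^sub>q :: "(real ^ 't) measure"
    and W\<^sub>K :: real
  assumes compact_A: "compact A"
    and lsc_f: "lower_semicontinuous_on {0..} f"
    and K_eq: "\<And>x y. x \<in> A \<Longrightarrow> y \<in> A \<Longrightarrow> K x y = f (norm (x - y))"
    and A1: "\<exists>\<mu>\<in>prob_measures_on A. energy A K \<mu> < \<infinity>"
    and A2: "\<exists>!\<mu>. equilibrium_measure A K \<mu>" "equilibrium_measure A K \<mu>\<^sub>e\<^sub>q"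
    and A3: "measure_support \<mu>\<^sub>e\<^sub>q = A"
    and A4: "0 < W\<^sub>K" "\<And>x. x \<in> A \<Longrightarrow> potential A K \<mu>\<^sub>e\<^sub>q x = ennreal W\<^sub>K"
  shows "max_polarization A K \<longlonglongrightarrow> ennreal W\<^sub>K
    \<and> (\<forall>\<omega>. (\<forall>N\<ge>2. polarization_optimal A K N (\<omega> N)) \<longrightarrow>
          weakly_converges_on A (\<lambda>N. counting_measure N (\<omega> N)) \<mu>\<^sub>e\<^sub>q)
    \<and> (\<forall>\<mu>. polarization_extremal A K \<mu> \<longleftrightarrow> \<mu> = \<mu>\<^sub>e\<^sub>q)"
proof -
  interpret constant_equilibrium_potential A f K \<mu>\<^sub>e\<^sub>q W\<^sub>K
    by unfold_locales (fact compact_A lsc_f K_eq A2 A3 A4)+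
  show ?thesis
    using max_polarization_tendsto polarization_optimal_weakly_converges polarization_extremal_iff
    by blast
qed

end
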